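(* Let the game, the communication network, the matrices $Q,\bar Q,\boldsymbol Q,M_\alpha$ and the constants $\bar\mu,\bar\ell,\bar\sigma$ be as described in the context. Let $\alpha>0$ be such that $\rho_\alpha:=\lambda_{\max}(M_\alpha)=\|M_\alpha\|<1$. Consider the algorithm: for every $i\in\mathcal I$, choose $x_i^0\in\Omega_i$ and $\boldsymbol x_{i,-i}^0\in\mathbb R^{n-n_i}$, and for $k=0,1,2,\dots$ each agent $i\in\mathcal I$ computes $$\hat{\boldsymbol x}_i^k=\sum_{j\in\mathcal N_i}w_{i,j}\boldsymbol x_j^k,\qquad x_i^{k+1}=\mathrm{proj}_{\Omega_i}\Big(\hat{\boldsymbol x}_{i,i}^k-\frac{\alpha}{q_i}\nabla_{x_i}J_i(\hat{\boldsymbol x}_i^k)\Big),\qquad \boldsymbol x_{i,-i}^{k+1}=\hat{\boldsymbol x}_{i,-i}^k .$$ Then, for any initial condition, the sequence $(\boldsymbol x^k)_{k\in\mathbb N}$ generated by this algorithm converges to $\boldsymbol x^*=\mathbf 1_N\otimes x^*$, where $x^*$ is the (unique) Nash equilibrium of the game, with linear rate: for all $k\in\mathbb N$, $$\|\boldsymbol x^k-\boldsymbol x^*\|_{\boldsymbol Q}\le(\sqrt{\rho_\alpha})^{k}\,\|\boldsymbol x^0-\boldsymbol x^*\|_{\boldsymbol Q}.$$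
   Context: Game. There are $N\ge2$ agents, $\mathcal I=\{1,\dots,N\}$. Agent $i$ chooses $x_i\in\Omega_i\subseteq\mathbb R^{n_i}$; $n=\sum_i n_i$, $x=(x_1,\dots,x_N)\in\mathbb R^n$ (stacked), $x_{-i}$ is the stack of all $x_j$, $j\ne i$, and $\Omega=\Omega_1\times\dots\times\Omega_N$. Agent $i$ has cost $J_i(x_i,x_{-i})$, $J_i:\mathbb R^n\to\mathbb R$. A Nash equilibrium is $x^*\in\Omega$ with $J_i(x_i^*,x_{-i}^* )\le\inf\{J_i(y_i,x_{-i}^* )\mid y_i\in\Omega_i\}$ for all $i$. Assumptions: each $\Omega_i$ is nonempty, closed and convex; each $J_i$ is continuous, and $J_i(\cdot,x_{-i})$ is convex and continuously differentiable for every $x_{-i}$; the pseudo-gradient $F:\mathbb R^n\to\mathbb R^n$, $F(x)=(\nabla_{x_i}J_i(x_i,x_{-i}))_{i\in\mathcal I}$ (stacked), is $\mu$-strongly monotone ($\langle F(x)-F(y),x-y\rangle\ge\mu\|x-y\|^2$ for all $x,y$) and $\ell_0$-Lipschitz for some $\mu,\ell_0>0$. Under these assumptions the Nash equilibrium exists and is unique. Network. Directed graph $\mathcal G(\mathcal I,\mathcal E)$, strongly connected, where $(i,j)\in\mathcal E$ iff agent $i$ can receive information from agent $j$; $\mathcal N_i=\{j\mid(i,j)\in\mathcal E\}$. Its weighted adjacency matrix $W=[w_{i,j}]$ has $w_{i,j}>0$ if $(i,j)\in\mathcal E$, $w_{i,j}=0$ otherwise, $w_{i,i}>0$ for all $i$,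 and $W\mathbf 1_N=\mathbf 1_N$. Let $q\in\mathbb R^N_{>0}$ be its left Perron-Frobenius eigenvector: $q^\top W=q^\top$, $\mathbf 1_N^\top q=1$. Set $Q=\mathrm{diag}(q_1,\dots,q_N)$, $\bar Q=\mathrm{diag}(q_1I_{n_1},\dots,q_NI_{n_N})\in\mathbb R^{n\times n}$, $\boldsymbol Q=Q\otimes I_n\in\mathbb R^{Nn\times Nn}$, and $\bar\sigma=\sigma_{N-1}(Q^{1/2}WQ^{-1/2})$, the second largest singular value (counted with multiplicity). Estimates. Agent $i$ keeps $\boldsymbol x_i=(\boldsymbol x_{i,j})_{j\in\mathcal I}\in\mathbb R^n$ with $\boldsymbol x_{i,j}\in\mathbb R^{n_j}$; $\boldsymbol x_{i,i}=x_i$ is its own strategy, $\boldsymbol x_{i,j}$ ($j\neq i$) is its estimate of agent $j$'s strategy, $\boldsymbol x_{i,-i}=(\boldsymbol x_{i,j})_{j\ne i}$, and $\boldsymbol x=(\boldsymbol x_1,\dots,\boldsymbol x_N)\in\mathbb R^{Nn}$. The same block notation is used for $\hat{\boldsymbol x}_i$. $\nabla_{x_i}J_i(\hat{\boldsymbol x}_i)$ is the partial gradient of $J_i$ with respect to its $i$-th block, evaluated at $\hat{\boldsymbol x}_i\in\mathbb R^n$. The extended pseudo-gradient is $\boldsymbol F:\mathbb R^{Nn}\to\mathbb R^n$, $\boldsymbol F(\boldsymbol x)=(\nabla_{x_i}J_i(\boldsymbol x_{i,i},\boldsymbol x_{i,-i}))_{i\in\mathcal I}$. Constants. For positive definite $P$,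 $\langle x,y\rangle_P=x^\top Py$ and $\|x\|_P=\sqrt{x^\top Px}$. $\bar\mu,\bar\ell>0$ are constants such that $\bar F:=\bar Q^{-1}F$ satisfies $\langle\bar F(x)-\bar F(y),x-y\rangle_{\bar Q}\ge\bar\mu\|x-y\|_{\bar Q}^2$ for all $x,y\in\mathbb R^n$, and $\bar{\boldsymbol F}:=\bar Q^{-1}\boldsymbol F$ satisfies $\|\bar{\boldsymbol F}(\boldsymbol x)-\bar{\boldsymbol F}(\boldsymbol y)\|_{\bar Q}\le\bar\ell\|\boldsymbol x-\boldsymbol y\|_{\boldsymbol Q}$ for all $\boldsymbol x,\boldsymbol y\in\mathbb R^{Nn}$ (such constants exist under the assumptions above). Finally $$M_\alpha=\begin{bmatrix}1-2\alpha\bar\mu\lambda_{\min}(Q)+\alpha^2\bar\ell^2 & 2\alpha\bar\ell\bar\sigma\\ 2\alpha\bar\ell\bar\sigma & (1+2\alpha\bar\ell+\alpha^2\bar\ell^2)\bar\sigma^2\end{bmatrix},$$ where $\lambda_{\min},\lambda_{\max}$ denote smallest and largest eigenvalues of a symmetric matrix. $\mathrm{proj}_{S}$ is the Euclidean projection onto the closed convex set $S$; $\otimes$ is the Kronecker product; $\mathbf 1_N$ is the all-ones vector. *)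

theory Defs
  imports "HOL-Analysis.Analysis" "HOL-Library.Multiset"
begin

(* The strategy spaces of the agents have different dimensions.  R^n is real^'c, and
   ow :: 'c => 'a assigns to each scalar coordinate the agent owning it, so that
   n_i = card {c. ow c = i}.  R^(n_i) is identified with the subspace of real^'c of vectors
   vanishing at all coordinates not owned by i, and R^n is the internal direct sum of these. *)

definition block_space :: "('c \<Rightarrow> 'a) \<Rightarrow> 'a \<Rightarrow> (real^'c::finite) set" where
  "block_space ow i = {v. \<forall>c. ow c \<noteq> i \<longrightarrow> v $ c = 0}"

definition block :: "('c \<Rightarrow> 'a) \<Rightarrow> 'a \<Rightarrow> real^'c \<Rightarrow> real^'c::finite" where
  "block ow i x = (\<chi> c. if ow c = i then x $ c else 0)"

(* the profile (y_i, x_{-i}); only the i-th block of y matters *)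
definition with_block :: "('c \<Rightarrow> 'a) \<Rightarrow> 'a \<Rightarrow> real^'c \<Rightarrow> real^'c \<Rightarrow> real^'c::finite" where
  "with_block ow i y x = (\<chi> c. if ow c = i then y $ c else x $ c)"

definition profiles :: "('c \<Rightarrow> 'a) \<Rightarrow> ('a \<Rightarrow> (real^'c) set) \<Rightarrow> (real^'c::finite) set" where
  "profiles ow \<Omega> = {x. \<forall>i. block ow i x \<in> \<Omega> i}"

(* the infimum is taken in the extended reals, where it always exists *)
definition nash_equilibrium ::
  "('c \<Rightarrow> 'a) \<Rightarrow> ('a \<Rightarrow> (real^'c) set) \<Rightarrow> ('a \<Rightarrow> real^'c \<Rightarrow> real) \<Rightarrow> real^'c::finite \<Rightarrow> bool" where
  "nash_equilibrium ow \<Omega> J x \<longleftrightarrow>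
     x \<in> profiles ow \<Omega> \<and>
     (\<forall>i. ereal (J i x) \<le> (INF y\<in>\<Omega> i. ereal (J i (with_block ow i y x))))"

(* The function y |-> f (y_i, x_{-i}) ignores the coordinates of y outside block i; its gradient
   on all of real^'c therefore lies in block_space ow i and is the gradient on R^(n_i). *)
definition partial_grad :: "('c \<Rightarrow> 'a) \<Rightarrow> 'a \<Rightarrow> (real^'c \<Rightarrow> real) \<Rightarrow> real^'c \<Rightarrow> real^'c::finite" where
  "partial_grad ow i f x = (THE g. GDERIV (\<lambda>y. f (with_block ow i y x)) x :> g)"

definition continuously_diff :: "('v::real_inner \<Rightarrow> real) \<Rightarrow> bool" where
  "continuously_diff f \<longleftrightarrow> (\<exists>g. (\<forall>y. GDERIV f y :> g y) \<and> continuous_on UNIV g)"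

definition pseudo_grad ::
  "('c \<Rightarrow> 'a) \<Rightarrow> ('a \<Rightarrow> real^'c \<Rightarrow> real) \<Rightarrow> real^'c \<Rightarrow> real^'c::finite" where
  "pseudo_grad ow J x = (\<chi> c. partial_grad ow (ow c) (J (ow c)) x $ c)"

(* Vectors of R^(Nn) are indexed by pairs (agent, coordinate); est X i is agent i's
   estimate of the whole profile, its own strategy included. *)
definition est :: "real^('a \<times> 'c) \<Rightarrow> 'a::finite \<Rightarrow> real^'c::finite" where
  "est X i = (\<chi> c. X $ (i, c))"

definition ext_pseudo_grad ::
  "('c \<Rightarrow> 'a) \<Rightarrow> ('a \<Rightarrow> real^'c \<Rightarrow> real) \<Rightarrow> real^('a::finite \<times> 'c) \<Rightarrow> real^'c::finite" where
  "ext_pseudo_grad ow J X = (\<chi> c. partial_grad ow (ow c) (J (ow c)) (est X (ow c)) $ c)"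

definition diag :: "real^'m \<Rightarrow> real^'m^'m::finite" where
  "diag d = (\<chi> i j. if i = j then d $ i else 0)"

definition kron_mat :: "real^'m^'m \<Rightarrow> real^'k^'k \<Rightarrow> real^('m \<times> 'k)^('m::finite \<times> 'k::finite)" where
  "kron_mat A B = (\<chi> p r. A $ fst p $ fst r * B $ snd p $ snd r)"

definition kron_vec :: "real^'m \<Rightarrow> real^'k \<Rightarrow> real^('m::finite \<times> 'k::finite)" where
  "kron_vec u v = (\<chi> p. u $ fst p * v $ snd p)"

definition Q_mat :: "real^'a \<Rightarrow> real^'a^'a::finite" where
  "Q_mat q = diag q"

definition Qbar_mat :: "('c \<Rightarrow> 'a) \<Rightarrow> real^'a::finite \<Rightarrow> real^'c^'c::finite" where
  "Qbar_mat ow q = diag (\<chi> c. q $ ow c)"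

definition Qbold_mat :: "real^'a \<Rightarrow> real^('a \<times> 'c)^('a::finite \<times> 'c::finite)" where
  "Qbold_mat q = kron_mat (Q_mat q) (mat 1)"

definition winner :: "real^'m^'m \<Rightarrow> real^'m \<Rightarrow> real^'m::finite \<Rightarrow> real" where
  "winner P x y = x \<bullet> (P *v y)"

definition wnorm :: "real^'m^'m \<Rightarrow> real^'m::finite \<Rightarrow> real" where
  "wnorm P x = sqrt (winner P x x)"

definition eigenspace :: "real^'m^'m \<Rightarrow> real \<Rightarrow> (real^'m::finite) set" where
  "eigenspace A l = {v. A *v v = l *\<^sub>R v}"

definition eigenvals :: "real^'m^'m::finite \<Rightarrow> real set" where
  "eigenvals A = {l. \<exists>v. v \<noteq> 0 \<and> v \<in> eigenspace A l}"

definition lambda_min :: "real^'m^'m::finite \<Rightarrow> real" where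
  "lambda_min A = Min (eigenvals A)"

definition lambda_max :: "real^'m^'m::finite \<Rightarrow> real" where
  "lambda_max A = Max (eigenvals A)"

(* Square roots of the eigenvalues of A^T A with multiplicity.  A^T A is symmetric, so geometric
   and algebraic multiplicities agree. *)
definition singular_values :: "real^'m^'m::finite \<Rightarrow> real multiset" where
  "singular_values A =
     (let B = transpose A ** A
      in \<Sum>l\<in>eigenvals B. replicate_mset (dim (eigenspace B l)) (sqrt l))"

(* singular values in decreasing order; index 1 is the second largest *)
definition second_largest_sv :: "real^'m^'m::finite \<Rightarrow> real" where
  "second_largest_sv A = rev (sorted_list_of_multiset (singular_values A)) ! 1"

(* Q^(1/2) W Q^(-1/2), where Q is diagonal with positive entries *)
definition sigma_bar :: "real^'a^'a \<Rightarrow> real^'a::finite \<Rightarrow> real" where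
  "sigma_bar W q =
     second_largest_sv (diag (\<chi> i. sqrt (q $ i)) ** W ** diag (\<chi> i. 1 / sqrt (q $ i)))"

definition M_mat :: "real \<Rightarrow> real \<Rightarrow> real \<Rightarrow> real^'a^'a \<Rightarrow> real^'a::finite \<Rightarrow> real^2^2" where
  "M_mat \<alpha> \<mu>b lb W q =
     (let s = sigma_bar W q
      in vector
          [vector [1 - 2 * \<alpha> * \<mu>b * lambda_min (Q_mat q) + \<alpha>\<^sup>2 * lb\<^sup>2, 2 * \<alpha> * lb * s],
           vector [2 * \<alpha> * lb * s, (1 + 2 * \<alpha> * lb + \<alpha>\<^sup>2 * lb\<^sup>2) * s\<^sup>2]])"

(* E is the edge relation: (i, j) is in E iff i can receive information from j *)
definition weighted_adjacency :: "('a \<times> 'a) set \<Rightarrow> real^'a^'a::finite \<Rightarrow> bool" where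
  "weighted_adjacency E W \<longleftrightarrow>
     (\<forall>i j. if (i, j) \<in> E then W $ i $ j > 0 else W $ i $ j = 0)"

definition mixed_est ::
  "('a \<times> 'a) set \<Rightarrow> real^'a^'a \<Rightarrow> real^('a \<times> 'c) \<Rightarrow> 'a::finite \<Rightarrow> real^'c::finite" where
  "mixed_est E W X i = (\<Sum>j\<in>{j. (i, j) \<in> E}. (W $ i $ j) *\<^sub>R est X j)"

definition generated_by_algorithm ::
  "('c \<Rightarrow> 'a) \<Rightarrow> ('a \<Rightarrow> (real^'c) set) \<Rightarrow> ('a \<Rightarrow> real^'c \<Rightarrow> real) \<Rightarrow> ('a \<times> 'a) set \<Rightarrow>
   real^'a^'a \<Rightarrow> real^'a \<Rightarrow> real \<Rightarrow> (nat \<Rightarrow> real^('a::finite \<times> 'c::finite)) \<Rightarrow> bool" where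
  "generated_by_algorithm ow \<Omega> J E W q \<alpha> X \<longleftrightarrow>
     (\<forall>i. block ow i (est (X 0) i) \<in> \<Omega> i) \<and>
     (\<forall>k i. let xh = mixed_est E W (X k) i in
        block ow i (est (X (Suc k)) i)
          = closest_point (\<Omega> i) (block ow i xh - (\<alpha> / q $ i) *\<^sub>R partial_grad ow i (J i) xh) \<and>
        (\<forall>c. ow c \<noteq> i \<longrightarrow> est (X (Suc k)) i $ c = xh $ c))"

end

theory Submission
  imports Defs
begin

text \<open>Nash equilibria are the solutions of the variational inequality of the pseudo-gradient, hence
  fixed points of the projected gradient step; Banach's theorem gives existence, strong monotonicity
  uniqueness. For the algorithm, split the error in the \<open>Q\<close>-weighted norm into its consensus part,
  of length \<open>A\<close>, and the orthogonal disagreement part, of length \<open>e\<close>. Mixing with \<open>W\<close> fixes the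
  average and shrinks the disagreement to at most \<open>\<sigma> e\<close>. Since the blockwise projection is
  nonexpansive, expanding the square of the gradient step bounds the new squared error by the
  quadratic form of \<open>M\<^sub>\<alpha>\<close> at \<open>(A, e)\<close>, hence by \<open>\<rho>\<^sub>\<alpha> (A\<^sup>2 + e\<^sup>2)\<close>.\<close>

section \<open>Symmetric matrices and the second singular value\<close>

text \<open>Mixing leaves the consensus part of the error unchanged, so only strong monotonicity can
  shrink it. Each agent, however, moves only its own coordinates, so monotonicity is available in
  the norm weighted by \<open>q $ ow c\<close>; comparing it with the unweighted length of the
  consensus error costs the factor \<open>lambda_min (Q_mat q)\<close>. The step
  \<open>\<alpha> / q $ i\<close> is chosen so that the \<open>q\<close>-weighted cross terms add up
  to an unweighted inner product with a gradient difference. On the spectral side,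
  \<open>sigma_bar\<close> is an entry of a sorted multiset. Instead of diagonalizing, a Rayleigh
  maximum \<open>m\<close> over the hyperplane orthogonal to the Perron vector is paired with the
  eigenvalue 1 of that vector. This gives two entries of the multiset, hence
  \<open>sqrt m \<le> sigma_bar W q\<close>, and \<open>m\<close> controls the whole
  hyperplane.\<close>

lemma symmetric_dot:
  fixes A :: "real^'n^'n"
  assumes "transpose A = A"
  shows "x \<bullet> (A *v y) = (A *v x) \<bullet> y"
  by (metis assms dot_lmul_matrix transpose_matrix_vector)

text \<open>Stands in for the spectral theorem. It is stated relative to an invariant subspace so
  that it yields both the largest eigenvalue on the whole space and the largest one orthogonal to a
  known eigenvector.\<close>

lemma rayleigh_maximizer:
  fixes A :: "real^'n^'n"
  assumes sym: "transpose A = A" and S: "subspace S" and inv: "\<And>x. x \<in> S \<Longrightarrow> A *v x \<in> S"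
    and "S \<noteq> {0}"
  obtains v m where "v \<in> S" "norm v = 1" "A *v v = m *\<^sub>R v"
    "\<And>x. x \<in> S \<Longrightarrow> x \<bullet> (A *v x) \<le> m * (x \<bullet> x)"
proof -
  have "compact (sphere 0 1 \<inter> S)"
    by (intro compact_Int_closed compact_sphere closed_subspace S)
  moreover obtain w where w: "w \<in> S" "w \<noteq> 0"
    using assms(4) subspace_0[OF S] by blast
  then have "(1 / norm w) *\<^sub>R w \<in> sphere 0 1 \<inter> S"
    using S by (simp add: subspace_mul)
  then have "sphere 0 1 \<inter> S \<noteq> {}" by blast
  moreover have "continuous_on (sphere 0 1 \<inter> S) (\<lambda>x. x \<bullet> (A *v x))"
    by (intro continuous_intros)
  ultimately have "\<exists>v\<in>sphere 0 1 \<inter> S. \<forall>x\<in>sphere 0 1 \<inter> S. x \<bullet> (A *v x) \<le> v \<bullet> (A *v v)"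
    by (rule continuous_attains_sup)
  then obtain v where v: "v \<in> sphere 0 1 \<inter> S"
    and max: "\<And>x. x \<in> sphere 0 1 \<inter> S \<Longrightarrow> x \<bullet> (A *v x) \<le> v \<bullet> (A *v v)"
    by blast
  define m where "m = v \<bullet> (A *v v)"
  have vS: "v \<in> S" and nv: "norm v = 1" using v by auto
  have bound: "x \<bullet> (A *v x) \<le> m * (x \<bullet> x)" if "x \<in> S" for x
  proof (cases "x = 0")
    case False
    have "(1 / norm x) *\<^sub>R x \<in> sphere 0 1 \<inter> S"
      using S that False by (simp add: subspace_mul)
    from max[OF this] have "(x \<bullet> (A *v x)) / (norm x)\<^sup>2 \<le> m"
      by (simp add: m_def matrix_vector_mult_scaleR power2_eq_square)
    then show ?thesis
      using False by (simp add: divide_le_eq power2_norm_eq_inner)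
  qed simp
  define g where "g x = m * (x \<bullet> x) - x \<bullet> (A *v x)" for x
  have g_nonneg: "0 \<le> g x" if "x \<in> S" for x
    using bound[OF that] by (simp add: g_def)
  \<comment> \<open>First-order condition at the maximizer: \<open>g\<close> is nonnegative on
    \<open>S\<close> and vanishes at \<open>v\<close>. Moving along the residual \<open>w\<close>
    changes it by \<open>2 * t * (w \<bullet> w)\<close> to first order, so the residual must be
    zero.\<close>
  define w where "w = m *\<^sub>R v - A *v v"
  have wS: "w \<in> S" unfolding w_def by (intro subspace_diff S subspace_mul vS inv)
  have expand: "g (v + t *\<^sub>R w) = 2 * t * (w \<bullet> w) + t\<^sup>2 * g w" for t
  proof -
    have vv: "v \<bullet> v = 1" using nv by (simp add: dot_square_norm)
    have sym_vw: "v \<bullet> (A *v w) = w \<bullet> (A *v v)"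
      by (metis inner_commute sym symmetric_dot)
    have wAv: "w \<bullet> (A *v v) = m * (v \<bullet> w) - w \<bullet> w"
      by (subst (4) w_def) (simp add: inner_diff_right inner_commute)
    have "g (v + t *\<^sub>R w) = m * (v \<bullet> v) - v \<bullet> (A *v v) + 2 * t * (m * (v \<bullet> w))
        - t * (v \<bullet> (A *v w)) - t * (w \<bullet> (A *v v)) + t\<^sup>2 * g w"
      by (simp add: g_def matrix_vector_right_distrib matrix_vector_mult_scaleR inner_add_left
          inner_add_right inner_commute[of w v] algebra_simps power2_eq_square)
    also have "\<dots> = 2 * t * (w \<bullet> w) + t\<^sup>2 * g w"
      unfolding sym_vw wAv vv m_def[symmetric] by (simp add: algebra_simps)
    finally show ?thesis .
  qed
  have "w \<bullet> w = 0"
  proof (rule ccontr)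
    assume "w \<bullet> w \<noteq> 0"
    then have pos: "w \<bullet> w > 0" by (simp add: less_le)
    \<comment> \<open>Small enough for the linear term to dominate; the \<open>+ 1\<close> keeps the
      denominator positive when \<open>g w = 0\<close>.\<close>
    define t where "t = - (w \<bullet> w) / (g w + 1)"
    have "0 \<le> g w" by (rule g_nonneg[OF wS])
    then have t: "t < 0" "- t * g w < w \<bullet> w"
      using pos by (auto simp: t_def field_simps)
    have "0 \<le> g (v + t *\<^sub>R w)"
      by (intro g_nonneg subspace_add S vS subspace_mul wS)
    then have "0 \<le> (- t) * (- t * g w - 2 * (w \<bullet> w))"
      unfolding expand by (simp add: algebra_simps power2_eq_square)
    moreover have "(- t) * (- t * g w - 2 * (w \<bullet> w)) < 0"
      using t pos by (intro mult_pos_neg) linarith+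
    ultimately show False by linarith
  qed
  then have "A *v v = m *\<^sub>R v" by (simp add: w_def)
  then show thesis using that vS nv bound by blast
qed

text \<open>One eigenvector per eigenvalue gives pairwise orthogonal, hence independent, vectors.
  Finiteness is what gives \<open>Max\<close>, \<open>Min\<close> and the sum in
  \<open>singular_values\<close> their intended meaning.\<close>

lemma finite_eigenvals:
  fixes A :: "real^'n^'n"
  assumes sym: "transpose A = A"
  shows "finite (eigenvals A)"
proof -
  have "\<forall>l\<in>eigenvals A. \<exists>v. v \<noteq> 0 \<and> A *v v = l *\<^sub>R v"
    by (auto simp: eigenvals_def eigenspace_def)
  then obtain v where v: "\<And>l. l \<in> eigenvals A \<Longrightarrow> v l \<noteq> 0 \<and> A *v v l = l *\<^sub>R v l"
    by metis
  have orth: "v l \<bullet> v k = 0" if "l \<in> eigenvals A" "k \<in> eigenvals A" "l \<noteq> k" for l k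
  proof -
    have "k * (v l \<bullet> v k) = l * (v l \<bullet> v k)"
      using symmetric_dot[OF sym, of "v l" "v k"] v that by simp
    then show ?thesis using that by simp
  qed
  have "pairwise orthogonal (v ` eigenvals A)"
    using orth by (auto simp: pairwise_def orthogonal_def)
  moreover have "0 \<notin> v ` eigenvals A" using v by force
  ultimately have "finite (v ` eigenvals A)"
    using pairwise_orthogonal_independent finiteI_independent by blast
  moreover have "inj_on v (eigenvals A)"
    using orth v by (intro inj_onI) (metis inner_eq_zero_iff)
  ultimately show ?thesis by (rule finite_imageD)
qed

section \<open>Multiplicities and the second largest singular value\<close>

text \<open>If entry 1 of the decreasing list were below \<open>min a b\<close>, only entry 0 could
  reach \<open>min a b\<close>, whereas the submultiset supplies two such occurrences. Counting
  occurrences also covers \<open>a = b\<close>.\<close>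

lemma second_largest_ge_min:
  fixes a b :: real
  assumes "{#a, b#} \<subseteq># M"
  shows "min a b \<le> rev (sorted_list_of_multiset M) ! 1"
proof (rule ccontr)
  define ys where "ys = rev (sorted_list_of_multiset M)"
  have M: "mset ys = M" by (simp add: ys_def)
  assume "\<not> min a b \<le> rev (sorted_list_of_multiset M) ! 1"
  then have lt: "ys ! 1 < min a b" by (simp only: ys_def not_le)
  have "2 \<le> length ys"
    using size_mset_mono[OF assms] M by (metis size_mset size_add_mset size_empty numeral_2_eq_2)
  then obtain y0 y1 zs where ys: "ys = y0 # y1 # zs"
    by (auto simp: numeral_2_eq_2 Suc_le_length_iff)
  have "sorted (rev ys)" by (simp add: ys_def)
  then have small: "\<forall>z\<in>set (y1 # zs). z < min a b"
    using lt unfolding ys sorted_wrt_rev by auto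
  have "size (filter_mset (\<lambda>z. min a b \<le> z) {#a, b#}) \<le> size (filter_mset (\<lambda>z. min a b \<le> z) M)"
    by (intro size_mset_mono multiset_filter_mono assms)
  moreover have "size (filter_mset (\<lambda>z. min a b \<le> z) {#a, b#}) = 2"
    by simp
  moreover have "filter (\<lambda>z. min a b \<le> z) (y1 # zs) = []"
    using small by (force simp: filter_empty_conv)
  then have "length (filter (\<lambda>z. min a b \<le> z) ys) \<le> 1"
    unfolding ys by (simp split: if_splits)
  then have "size (filter_mset (\<lambda>z. min a b \<le> z) M) \<le> 1"
    by (metis M mset_filter size_mset)
  ultimately show False by linarith
qed

text \<open>For \<open>l = m\<close> the orthogonal vectors make one eigenspace at least
  two-dimensional, so its summand holds two copies; for distinct eigenvalues two different summands
  give one copy each.\<close>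

lemma singular_values_orthogonal_pair:
  fixes A :: "real^'n^'n"
  assumes u: "u \<noteq> 0" "(transpose A ** A) *v u = l *\<^sub>R u"
    and v: "v \<noteq> 0" "(transpose A ** A) *v v = m *\<^sub>R v"
    and orth: "u \<bullet> v = 0"
  shows "{#sqrt l, sqrt m#} \<subseteq># singular_values A"
proof -
  define B where "B = transpose A ** A"
  define f where "f l = replicate_mset (dim (eigenspace B l)) (sqrt l)" for l
  have "transpose B = B" by (simp add: B_def matrix_transpose_mul)
  then have fin: "finite (eigenvals B)" by (rule finite_eigenvals)
  have sv: "singular_values A = sum f (eigenvals B)"
    by (simp add: singular_values_def Let_def B_def f_def)
  have uE: "u \<in> eigenspace B l" and vE: "v \<in> eigenspace B m"
    using u v by (simp_all add: B_def eigenspace_def)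
  then have ev: "l \<in> eigenvals B" "m \<in> eigenvals B"
    using u(1) v(1) by (auto simp: eigenvals_def)
  have sub: "sum f T \<subseteq># singular_values A" if "T \<subseteq> eigenvals B" for T
    unfolding sv using sum.subset_diff[OF that fin, of f] by simp
  show ?thesis
  proof (cases "l = m")
    case True
    have "pairwise orthogonal {u, v}"
      using orth by (auto simp: pairwise_def orthogonal_def inner_commute)
    then have "independent {u, v}"
      using u v by (intro pairwise_orthogonal_independent) auto
    then have "card {u, v} \<le> dim (eigenspace B l)"
      using uE vE True by (intro independent_card_le_dim) auto
    moreover have "u \<noteq> v" using orth u by auto
    ultimately have "2 \<le> dim (eigenspace B l)" by simp
    then have "replicate_mset 2 (sqrt l) \<subseteq># f l"
      by (auto simp: f_def subseteq_mset_def)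
    moreover have "f l \<subseteq># singular_values A" using sub[of "{l}"] ev by simp
    ultimately show ?thesis
      using True by (auto simp: numeral_2_eq_2)
  next
    case False
    have "{#sqrt k#} \<subseteq># f k" if "w \<noteq> 0" "w \<in> eigenspace B k" for w k
    proof -
      have "dim (eigenspace B k) \<noteq> 0" using that by (auto simp: dim_eq_0)
      then show ?thesis by (simp add: f_def)
    qed
    then have "{#sqrt l#} + {#sqrt m#} \<subseteq># f l + f m"
      using u(1) v(1) uE vE by (intro subset_mset.add_mono) auto
    moreover have "f l + f m \<subseteq># singular_values A"
      using sub[of "{l, m}"] ev False by simp
    ultimately show ?thesis by (simp add: add_mset_commute)
  qed
qed

text \<open>The Rayleigh maximum over the whole space is an eigenvalue and bounds all the others, so
  it is the \<open>Max\<close> in the definition.\<close>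

lemma lambda_max_eigenvalue:
  fixes A :: "real^'n^'n"
  assumes sym: "transpose A = A"
  obtains v where "v \<noteq> 0" "A *v v = lambda_max A *\<^sub>R v"
    "\<And>x. x \<bullet> (A *v x) \<le> lambda_max A * (x \<bullet> x)"
proof -
  have "(UNIV :: (real^'n) set) \<noteq> {0}"
    by (metis UNIV_I axis_eq_0_iff singletonD zero_neq_one)
  then obtain v m where v: "norm v = 1" "A *v v = m *\<^sub>R v"
    and bound: "\<And>x. x \<bullet> (A *v x) \<le> m * (x \<bullet> x)"
    using rayleigh_maximizer[OF sym subspace_UNIV] by (metis UNIV_I)
  have "l \<le> m" if "l \<in> eigenvals A" for l
  proof -
    obtain w where w: "w \<noteq> 0" "A *v w = l *\<^sub>R w"
      using \<open>l \<in> eigenvals A\<close> by (auto simp: eigenvals_def eigenspace_def)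
    then show ?thesis using bound[of w] by simp
  qed
  moreover have "m \<in> eigenvals A"
    using v unfolding eigenvals_def eigenspace_def by (intro CollectI exI[of _ v]) auto
  ultimately have "lambda_max A = m"
    unfolding lambda_max_def using finite_eigenvals[OF sym] by (intro Max_eqI) auto
  moreover have "v \<noteq> 0" using v(1) by auto
  ultimately show thesis using that[of v] v(2) bound by simp
qed

section \<open>Operator norm of a symmetric 2 by 2 matrix\<close>

lemma matrix_vector_mult_2:
  fixes M :: "real^2^2"
  shows "(M *v x) $ 1 = M $ 1 $ 1 * x $ 1 + M $ 1 $ 2 * x $ 2"
    "(M *v x) $ 2 = M $ 2 $ 1 * x $ 1 + M $ 2 $ 2 * x $ 2"
  by (simp_all add: matrix_vector_mult_def sum_2)

text \<open>By Cayley--Hamilton, \<open>\<bar>M x\<bar>\<^sup>2 = tr M \<cdot> x\<^sup>T M x - det M \<cdot> \<bar>x\<bar>\<^sup>2\<close>; for nonnegative trace the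
  right-hand side is largest at the top eigenvector.\<close>

lemma onorm_eq_lambda_max_2:
  fixes M :: "real^2^2"
  assumes sym: "transpose M = M" and trace: "0 \<le> M $ 1 $ 1 + M $ 2 $ 2"
  shows "lambda_max M = onorm ((*v) M)" "0 \<le> lambda_max M"
proof -
  define L where "L = lambda_max M"
  define T where "T = M $ 1 $ 1 + M $ 2 $ 2"
  define d where "d = M $ 1 $ 1 * M $ 2 $ 2 - M $ 1 $ 2 * M $ 1 $ 2"
  have T: "0 \<le> T" using trace by (simp add: T_def)
  obtain v where v: "v \<noteq> 0" "M *v v = L *\<^sub>R v"
    and bound: "\<And>x. x \<bullet> (M *v x) \<le> L * (x \<bullet> x)"
    using lambda_max_eigenvalue[OF sym] unfolding L_def by blast
  have M21: "M $ 2 $ 1 = M $ 1 $ 2"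
    using arg_cong[OF sym, of "\<lambda>B. B $ 1 $ 2"] by (simp add: transpose_def)
  have CH: "(M *v x) \<bullet> (M *v x) = T * (x \<bullet> (M *v x)) - d * (x \<bullet> x)" for x
    unfolding inner_vec_def sum_2 matrix_vector_mult_2 T_def d_def M21 inner_real_def
    by (simp add: algebra_simps)
  have "(L * L) * (v \<bullet> v) = (T * L - d) * (v \<bullet> v)"
    using CH[of v] v by (simp add: algebra_simps)
  then have char: "L * L = T * L - d" using v(1) by simp
  \<comment> \<open>The Rayleigh bound at the coordinate vectors puts both diagonal entries below
    \<open>L\<close>, so \<open>2 * L\<close> is at least the trace.\<close>
  have "M $ 1 $ 1 \<le> L"
    using bound[of "axis 1 1"]
    by (simp add: inner_axis' matrix_vector_mult_2 inner_axis_axis) (simp add: axis_def)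
  moreover have "M $ 2 $ 2 \<le> L"
    using bound[of "axis 2 1"]
    by (simp add: inner_axis' matrix_vector_mult_2 inner_axis_axis) (simp add: axis_def)
  ultimately have L: "0 \<le> L" using trace by linarith
  have "norm (M *v x) \<le> L * norm x" for x
  proof -
    have "(norm (M *v x))\<^sup>2 \<le> T * (L * (x \<bullet> x)) - d * (x \<bullet> x)"
      unfolding power2_norm_eq_inner CH using mult_left_mono[OF bound T] by simp
    also have "\<dots> = (L * norm x)\<^sup>2"
      by (simp add: power_mult_distrib power2_norm_eq_inner power2_eq_square[of L] char)
        (simp add: algebra_simps)
    finally show ?thesis using L by (simp add: power2_le_iff_abs_le)
  qed
  then have "onorm ((*v) M) \<le> L" by (intro onorm_bound L)
  moreover have "L \<le> onorm ((*v) M)"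
    using onorm[OF matrix_vector_mul_bounded_linear, of M v] v L by simp
  ultimately show "lambda_max M = onorm ((*v) M)" "0 \<le> lambda_max M"
    using L by (simp_all add: L_def)
qed

section \<open>Diagonal weights and row-stochastic mixing\<close>

lemma diag_mult_vec: "diag d *v x = (\<chi> i. d $ i * x $ i)"
  by (simp add: vec_eq_iff diag_def matrix_vector_mult_def if_distrib[of "\<lambda>a. a * _"] cong: if_cong)

lemma transpose_diag: "transpose (diag d) = diag d"
  by (simp add: vec_eq_iff diag_def transpose_def)

lemma lambda_min_diag_le: "lambda_min (diag d) \<le> d $ i"
proof -
  have "diag d *v axis i 1 = d $ i *\<^sub>R axis i 1"
    by (simp add: diag_mult_vec vec_eq_iff axis_def)
  then have "d $ i \<in> eigenvals (diag d)"
    unfolding eigenvals_def eigenspace_def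
    by (intro CollectI exI[of _ "axis i 1"]) (simp add: axis_eq_0_iff)
  then show ?thesis
    unfolding lambda_min_def by (intro Min_le finite_eigenvals transpose_diag)
qed

text \<open>Stationarity of \<open>q\<close>: after swapping the sums, the inner one is an entry of
  \<open>q v* W\<close>. This is why mixing does not move the weighted average.\<close>

lemma sum_vector_matrix_mult:
  fixes W :: "real^'a^'a"
  assumes "q v* W = q"
  shows "(\<Sum>i\<in>UNIV. q $ i * (\<Sum>j\<in>UNIV. W $ i $ j * f j)) = (\<Sum>j\<in>UNIV. q $ j * f j)"
proof -
  have "(\<Sum>i\<in>UNIV. q $ i * (\<Sum>j\<in>UNIV. W $ i $ j * f j))
      = (\<Sum>j\<in>UNIV. (\<Sum>i\<in>UNIV. W $ i $ j * q $ i) * f j)"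
    by (simp add: sum_distrib_left sum_distrib_right mult_ac) (rule sum.swap)
  also have "\<dots> = (\<Sum>j\<in>UNIV. q $ j * f j)"
  proof (rule sum.cong)
    show "(\<Sum>i\<in>UNIV. W $ i $ j * q $ i) * f j = q $ j * f j" for j
      using arg_cong[OF assms, of "\<lambda>z. z $ j"] by (simp add: vector_matrix_mult_def mult.commute)
  qed simp
  finally show ?thesis .
qed

text \<open>Jensen's inequality for the square in each row, followed by stationarity of
  \<open>q\<close>. It will show that no eigenvalue on the complement of the Perron vector exceeds
  1.\<close>

lemma stochastic_nonexpansive:
  fixes W :: "real^'a^'a"
  assumes W: "\<And>i j. 0 \<le> W $ i $ j" "W *v (\<chi> i. 1) = (\<chi> i. 1)"
    and q: "\<And>i. 0 < q $ i" "q v* W = q"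
  shows "(\<Sum>i\<in>UNIV. q $ i * ((W *v x) $ i)\<^sup>2) \<le> (\<Sum>i\<in>UNIV. q $ i * (x $ i)\<^sup>2)"
proof -
  have "((W *v x) $ i)\<^sup>2 \<le> (\<Sum>j\<in>UNIV. W $ i $ j * (x $ j)\<^sup>2)" for i
  proof -
    define s where "s = (W *v x) $ i"
    have W1: "(\<Sum>j\<in>UNIV. W $ i $ j) = 1"
      using arg_cong[OF W(2), of "\<lambda>z. z $ i"] by (simp add: matrix_vector_mult_def)
    have s: "(\<Sum>j\<in>UNIV. W $ i $ j * x $ j) = s"
      by (simp add: s_def matrix_vector_mult_def)
    \<comment> \<open>The variance of \<open>x\<close> under the probability vector in row
      \<open>i\<close>.\<close>
    have "0 \<le> (\<Sum>j\<in>UNIV. W $ i $ j * (x $ j - s)\<^sup>2)"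
      by (intro sum_nonneg mult_nonneg_nonneg W) simp
    also have "\<dots> = (\<Sum>j\<in>UNIV. W $ i $ j * (x $ j)\<^sup>2 - 2 * s * (W $ i $ j * x $ j) + s\<^sup>2 * W $ i $ j)"
      by (intro sum.cong refl) (simp add: power2_eq_square algebra_simps)
    also have "\<dots> = (\<Sum>j\<in>UNIV. W $ i $ j * (x $ j)\<^sup>2) - 2 * s * s + s\<^sup>2"
      by (simp only: sum.distrib sum_subtractf sum_distrib_left[symmetric] s W1 mult_1_right)
    finally show ?thesis by (simp add: s_def[symmetric] power2_eq_square)
  qed
  then have "(\<Sum>i\<in>UNIV. q $ i * ((W *v x) $ i)\<^sup>2)
      \<le> (\<Sum>i\<in>UNIV. q $ i * (\<Sum>j\<in>UNIV. W $ i $ j * (x $ j)\<^sup>2))"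
    using q(1) by (intro sum_mono mult_left_mono) (auto intro: less_imp_le)
  also have "\<dots> = (\<Sum>i\<in>UNIV. q $ i * (x $ i)\<^sup>2)"
    by (rule sum_vector_matrix_mult[OF q(2)])
  finally show ?thesis .
qed

text \<open>Scaling coordinates by \<open>sqrt (q $ i)\<close> turns the weighted norm into the
  Euclidean one, \<open>W\<close> into \<open>A\<close>, and the condition of zero weighted mean
  into orthogonality to \<open>r\<close>. As \<open>r\<close> is fixed by \<open>B\<close>, its
  complement is invariant and has its own Rayleigh maximum \<open>m\<close>.\<close>

lemma sigma_bar_contraction:
  fixes W :: "real^'a^'a"
  assumes agents: "2 \<le> CARD('a)"
    and W: "\<And>i j. 0 \<le> W $ i $ j" "W *v (\<chi> i. 1) = (\<chi> i. 1)"
    and q: "\<And>i. 0 < q $ i" "q v* W = q"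
  shows "0 \<le> sigma_bar W q"
    "(\<Sum>i\<in>UNIV. q $ i * x $ i) = 0 \<Longrightarrow>
      (\<Sum>i\<in>UNIV. q $ i * ((W *v x) $ i)\<^sup>2) \<le> (sigma_bar W q)\<^sup>2 * (\<Sum>i\<in>UNIV. q $ i * (x $ i)\<^sup>2)"
proof -
  define r where "r = (\<chi> i. sqrt (q $ i))"
  define A where "A = diag r ** W ** diag (\<chi> i. 1 / sqrt (q $ i))"
  define B where "B = transpose A ** A"
  have sq: "sqrt (q $ i) * sqrt (q $ i) = q $ i" "sqrt (q $ i) > 0" "sqrt (q $ i) \<noteq> 0" for i
    using q(1)[of i] by simp_all
  have sigma: "sigma_bar W q = rev (sorted_list_of_multiset (singular_values A)) ! 1"
    by (simp add: sigma_bar_def second_largest_sv_def A_def r_def)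
  have A_vec: "A *v (\<chi> i. sqrt (q $ i) * y $ i) = (\<chi> i. sqrt (q $ i) * (W *v y) $ i)" for y
    using sq(3)
    by (simp add: A_def r_def matrix_vector_mul_assoc[symmetric] diag_mult_vec vec_eq_iff
        vec_lambda_eta)
  have scale: "z = (\<chi> i. sqrt (q $ i) * (\<chi> i. z $ i / sqrt (q $ i)) $ i)" for z :: "real^'a"
    using sq(3) by (simp add: vec_eq_iff)
  have dot_scale: "(\<chi> i. sqrt (q $ i) * y $ i) \<bullet> (\<chi> i. sqrt (q $ i) * z $ i)
      = (\<Sum>i\<in>UNIV. q $ i * (y $ i * z $ i))" for y z :: "real^'a"
    unfolding inner_vec_def inner_real_def vec_lambda_beta
    by (intro sum.cong refl) (metis (no_types, opaque_lifting) mult.assoc mult.left_commute sq(1))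
  have B_dot: "y \<bullet> (B *v z) = (A *v y) \<bullet> (A *v z)" for y z
    unfolding B_def matrix_vector_mul_assoc[symmetric]
    by (metis dot_lmul_matrix inner_commute transpose_matrix_vector)
  have symB: "transpose B = B" by (simp add: B_def matrix_transpose_mul)
  have r1: "r = (\<chi> i. sqrt (q $ i) * (\<chi> i. 1) $ i)" by (simp add: r_def)
  have Ar: "A *v r = r" unfolding r1 A_vec W(2) ..
  \<comment> \<open>Row sums give \<open>A *v r = r\<close>; the left eigenvector property then
    gives \<open>(A *v z) \<bullet> r = z \<bullet> r\<close>, so \<open>r\<close> is fixed by
    \<open>B\<close> as well.\<close>
  have "z \<bullet> (B *v r) = z \<bullet> r" for z
  proof -
    define y :: "real^'a" where "y = (\<chi> i. z $ i / sqrt (q $ i))"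
    have z: "z = (\<chi> i. sqrt (q $ i) * y $ i)" unfolding y_def by (rule scale)
    have "z \<bullet> (B *v r) = (\<Sum>i\<in>UNIV. q $ i * (W *v y) $ i)"
      unfolding B_dot Ar unfolding z A_vec unfolding r1 dot_scale by simp
    also have "\<dots> = (\<Sum>i\<in>UNIV. q $ i * y $ i)"
      unfolding matrix_vector_mult_def by (simp add: sum_vector_matrix_mult[OF q(2)])
    also have "\<dots> = z \<bullet> r" unfolding z r1 dot_scale by simp
    finally show ?thesis .
  qed
  then have Br: "B *v r = 1 *\<^sub>R r" by (metis scaleR_one vector_eq_ldot)
  have r0: "r \<noteq> 0" using sq(3) by (simp add: r_def vec_eq_iff)
  define S where "S = {z. r \<bullet> z = 0}"
  have "subspace S" unfolding S_def by (rule subspace_hyperplane)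
  moreover have "B *v z \<in> S" if "z \<in> S" for z
    using that symmetric_dot[OF symB, of r z] by (simp add: S_def Br)
  \<comment> \<open>The hyperplane has dimension \<open>CARD('a) - 1\<close>, which is positive
    because there are at least two agents.\<close>
  moreover have "S \<noteq> {0}"
  proof
    assume "S = {0}"
    then have "dim S = 0" by simp
    moreover have "dim S = DIM(real^'a) - 1"
      unfolding S_def by (rule dim_hyperplane[OF r0])
    ultimately show False using agents by simp
  qed
  ultimately obtain v m where v: "v \<in> S" "norm v = 1" "B *v v = m *\<^sub>R v"
    and bound: "\<And>z. z \<in> S \<Longrightarrow> z \<bullet> (B *v z) \<le> m * (z \<bullet> z)"
    using rayleigh_maximizer[OF symB] by metis
  have v0: "v \<noteq> 0" using v(2) by auto
  have vv: "v \<bullet> v = 1" using v(2) by (simp add: dot_square_norm)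
  have m: "m = (A *v v) \<bullet> (A *v v)"
    using B_dot[of v v] v(3) vv by simp
  \<comment> \<open>Ensures that the smaller of the two singular values \<open>1\<close> and
    \<open>sqrt m\<close> is \<open>sqrt m\<close>, the one that governs the contraction.\<close>
  have "m \<le> 1"
  proof -
    define y :: "real^'a" where "y = (\<chi> i. v $ i / sqrt (q $ i))"
    have z: "v = (\<chi> i. sqrt (q $ i) * y $ i)" unfolding y_def by (rule scale)
    have "m = (\<Sum>i\<in>UNIV. q $ i * ((W *v y) $ i)\<^sup>2)"
      unfolding m z A_vec dot_scale by (simp add: power2_eq_square)
    also have "\<dots> \<le> (\<Sum>i\<in>UNIV. q $ i * (y $ i)\<^sup>2)"
      by (rule stochastic_nonexpansive[OF W q])
    also have "\<dots> = v \<bullet> v" unfolding z dot_scale by (simp add: power2_eq_square)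
    finally show ?thesis using vv by simp
  qed
  have "{#sqrt 1, sqrt m#} \<subseteq># singular_values A"
    using Br v(1,3) by (intro singular_values_orthogonal_pair[OF r0 _ v0]) (simp_all add: B_def S_def)
  from second_largest_ge_min[OF this] have sm: "sqrt m \<le> sigma_bar W q"
    using \<open>m \<le> 1\<close> by (simp add: sigma min_def split: if_splits)
  have m0: "0 \<le> m" unfolding m by simp
  then show s0: "0 \<le> sigma_bar W q" using sm by (meson order_trans real_sqrt_ge_zero)
  have "m \<le> (sigma_bar W q)\<^sup>2"
    using power_mono[OF sm, of 2] m0 by simp
  assume x: "(\<Sum>i\<in>UNIV. q $ i * x $ i) = 0"
  define z where "z = (\<chi> i. sqrt (q $ i) * x $ i)"
  have "r \<bullet> z = 0" unfolding r1 z_def dot_scale using x by simp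
  then have "(A *v z) \<bullet> (A *v z) \<le> m * (z \<bullet> z)"
    using bound[of z] by (simp add: S_def B_dot)
  also have "\<dots> \<le> (sigma_bar W q)\<^sup>2 * (z \<bullet> z)"
    using \<open>m \<le> (sigma_bar W q)\<^sup>2\<close> by (intro mult_right_mono) simp_all
  finally show "(\<Sum>i\<in>UNIV. q $ i * ((W *v x) $ i)\<^sup>2)
      \<le> (sigma_bar W q)\<^sup>2 * (\<Sum>i\<in>UNIV. q $ i * (x $ i)\<^sup>2)"
    unfolding z_def A_vec dot_scale by (simp add: power2_eq_square)
qed

section \<open>Nash equilibria as solutions of a variational inequality\<close>

lemma linear_block: "linear (block ow i)"
  by (rule linearI) (auto simp: block_def vec_eq_iff)

lemmas block_add = linear_add[OF linear_block]
  and block_diff = linear_diff[OF linear_block]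
  and block_scaleR = linear_scale[OF linear_block]

lemma block_dot: "block ow i u \<bullet> v = (\<Sum>c\<in>UNIV. if ow c = i then u $ c * v $ c else 0)"
  by (auto simp: inner_vec_def block_def intro: sum.cong)

lemma block_dot_commute: "block ow i u \<bullet> v = u \<bullet> block ow i v"
  by (auto simp: inner_vec_def block_def intro: sum.cong)

lemma block_eq_self: "u \<in> block_space ow i \<Longrightarrow> block ow i u = u"
  by (auto simp: block_def block_space_def vec_eq_iff)

lemma block_in_block_space: "block ow i u \<in> block_space ow i"
  by (simp add: block_def block_space_def)

lemma with_block_cong:
  assumes "block ow i y = block ow i z"
  shows "with_block ow i y x = with_block ow i z x"
proof -
  have "y $ c = z $ c" if "ow c = i" for c
    using arg_cong[OF assms, of "\<lambda>v. v $ c"] that by (simp add: block_def)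
  then show ?thesis by (simp add: with_block_def vec_eq_iff)
qed

lemma with_block_self: "with_block ow i x x = x"
  by (simp add: with_block_def vec_eq_iff)

text \<open>Every coordinate has exactly one owner. This converts agentwise sums over blocks into
  sums over the coordinates of the stacked gradient.\<close>

lemma sum_over_owners:
  fixes ow :: "'c::finite \<Rightarrow> 'a::finite" and f :: "'a \<Rightarrow> 'c \<Rightarrow> 'b::comm_monoid_add"
  shows "(\<Sum>i\<in>UNIV. \<Sum>c\<in>UNIV. if ow c = i then f i c else 0) = (\<Sum>c\<in>UNIV. f (ow c) c)"
  by (subst sum.swap) simp

lemma pseudo_grad_dot:
  fixes ow :: "'c::finite \<Rightarrow> 'a::finite"
  shows "pseudo_grad ow J x \<bullet> v = (\<Sum>i\<in>UNIV. partial_grad ow i (J i) x \<bullet> block ow i v)"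
proof -
  have "(\<Sum>i\<in>UNIV. partial_grad ow i (J i) x \<bullet> block ow i v)
      = (\<Sum>i\<in>UNIV. \<Sum>c\<in>UNIV. if ow c = i then partial_grad ow i (J i) x $ c * v $ c else 0)"
    by (simp add: block_dot_commute[symmetric] block_dot)
  also have "\<dots> = pseudo_grad ow J x \<bullet> v"
    unfolding sum_over_owners by (simp add: inner_vec_def pseudo_grad_def)
  finally show ?thesis ..
qed

section \<open>Partial gradients and first-order optimality\<close>

lemma gderiv_along_line:
  assumes "GDERIV \<phi> x :> g"
  shows "((\<lambda>t. \<phi> (x + t *\<^sub>R d)) has_real_derivative (d \<bullet> g)) (at 0)"
proof -
  have "((\<lambda>t::real. x + t *\<^sub>R d) has_derivative (\<lambda>t. t *\<^sub>R d)) (at 0)"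
    by (auto intro!: derivative_eq_intros)
  moreover have "(\<phi> has_derivative (\<lambda>h. h \<bullet> g)) (at (x + 0 *\<^sub>R d))"
    using assms by (simp add: gderiv_def)
  ultimately have "((\<lambda>t. \<phi> (x + t *\<^sub>R d)) has_derivative (\<lambda>t. (t *\<^sub>R d) \<bullet> g)) (at 0)"
    by (rule has_derivative_compose)
  moreover have "(\<lambda>t. (t *\<^sub>R d) \<bullet> g) = (*) (d \<bullet> g)"
    by (simp add: fun_eq_iff)
  ultimately show ?thesis
    by (simp add: has_field_derivative_def)
qed

text \<open>\<open>partial_grad\<close> is a definite description, so existence and uniqueness of
  the gradient must precede any use of it.\<close>

lemma gderiv_partial_grad:
  assumes "continuously_diff (\<lambda>y. f (with_block ow i y x))"
  shows "GDERIV (\<lambda>y. f (with_block ow i y x)) x :> partial_grad ow i f x"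
proof -
  obtain g where g: "GDERIV (\<lambda>y. f (with_block ow i y x)) x :> g"
    using assms by (auto simp: continuously_diff_def)
  have "g' = g" if "GDERIV (\<lambda>y. f (with_block ow i y x)) x :> g'" for g'
  proof -
    have "(\<lambda>h. h \<bullet> g') = (\<lambda>h. h \<bullet> g)"
      using that g unfolding gderiv_def by (rule has_derivative_unique)
    then show ?thesis by (metis vector_eq_ldot)
  qed
  then show ?thesis unfolding partial_grad_def using g by (rule theI[rotated])
qed

text \<open>Moving a coordinate that another agent owns leaves the function constant, so that
  directional derivative vanishes.\<close>

lemma block_partial_grad:
  assumes "continuously_diff (\<lambda>y. f (with_block ow i y x))"
  shows "block ow i (partial_grad ow i f x) = partial_grad ow i f x"
proof -
  have "partial_grad ow i f x $ c = 0" if "ow c \<noteq> i" for c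
  proof -
    have "with_block ow i (x + t *\<^sub>R axis c 1) x = x" for t
      using that by (auto simp: with_block_def vec_eq_iff axis_def)
    then have "((\<lambda>t::real. f x) has_real_derivative (axis c 1 \<bullet> partial_grad ow i f x)) (at 0)"
      using gderiv_along_line[OF gderiv_partial_grad[OF assms], of "axis c 1"] by simp
    then have "axis c 1 \<bullet> partial_grad ow i f x = 0"
      by (rule DERIV_unique) simp
    then show ?thesis by (simp add: inner_axis')
  qed
  then show ?thesis by (auto simp: block_def vec_eq_iff)
qed

text \<open>Agentwise form of the variational inequality of the pseudo-gradient over the product
  set: blocks vary independently, so it can be tested one block at a time.\<close>

definition variational_solution ::
  "('c \<Rightarrow> 'a) \<Rightarrow> ('a \<Rightarrow> (real^'c) set) \<Rightarrow> ('a \<Rightarrow> real^'c \<Rightarrow> real) \<Rightarrow> real^'c::finite \<Rightarrow> bool" where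
  "variational_solution ow \<Omega> J x \<longleftrightarrow> x \<in> profiles ow \<Omega> \<and>
     (\<forall>i. \<forall>y\<in>\<Omega> i. 0 \<le> (y - block ow i x) \<bullet> partial_grad ow i (J i) x)"

text \<open>First-order optimality for each agent, reduced to one real variable along the segment
  from the own strategy to \<open>y\<close>. A negative slope at 0 would contradict minimality, and
  a convex function lies above its tangent.\<close>

lemma nash_equilibrium_iff_variational_solution:
  assumes \<Omega>: "\<And>i. \<Omega> i \<subseteq> block_space ow i" "\<And>i. convex (\<Omega> i)"
    and J: "\<And>i x. convex_on (block_space ow i) (\<lambda>y. J i (with_block ow i y x))"
      "\<And>i x. continuously_diff (\<lambda>y. J i (with_block ow i y x))"
  shows "nash_equilibrium ow \<Omega> J x \<longleftrightarrow> variational_solution ow \<Omega> J x"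
proof -
  have "(J i x \<le> J i (with_block ow i y x)) \<longleftrightarrow> h 0 \<le> h 1"
    "(h has_real_derivative ((y - block ow i x) \<bullet> partial_grad ow i (J i) x)) (at 0)"
    "convex_on UNIV h"
    "\<And>t. h t = J i (with_block ow i (block ow i x + t *\<^sub>R (y - block ow i x)) x)"
    if y: "y \<in> \<Omega> i" and h: "h = (\<lambda>t. J i (with_block ow i (x + t *\<^sub>R (y - block ow i x)) x))"
    for i y h
  proof -
    \<comment> \<open>The same line inside the block space: the derivative is taken at the full
      profile \<open>x\<close>, while convexity is given on \<open>block_space ow i\<close>. Both
      lines give the same cost since \<open>with_block\<close> reads only block
      \<open>i\<close>.\<close>
    define P where "P t = block ow i x + t *\<^sub>R (y - block ow i x)" for t
    have yb: "block ow i y = y" using y \<Omega>(1) by (intro block_eq_self) auto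
    have bb: "block ow i (block ow i x) = block ow i x"
      by (intro block_eq_self block_in_block_space)
    have P_block: "block ow i (P t) = P t" for t
      by (simp add: P_def block_add block_diff block_scaleR yb bb)
    show hP: "h t = J i (with_block ow i (block ow i x + t *\<^sub>R (y - block ow i x)) x)" for t
      unfolding h
      by (intro arg_cong[of _ _ "J i"] with_block_cong) (simp add: block_add block_diff block_scaleR yb bb)
    show "(J i x \<le> J i (with_block ow i y x)) \<longleftrightarrow> h 0 \<le> h 1"
      unfolding hP[of 1] by (simp add: h with_block_self)
    show "(h has_real_derivative ((y - block ow i x) \<bullet> partial_grad ow i (J i) x)) (at 0)"
      unfolding h by (rule gderiv_along_line[OF gderiv_partial_grad[OF J(2)]])
    have P_in: "P t \<in> block_space ow i" for t
      by (metis P_block block_in_block_space)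
    show "convex_on UNIV h"
    proof (rule convex_onI)
      fix s a b :: real assume s: "0 < s" "s < 1"
      have "P ((1 - s) *\<^sub>R a + s *\<^sub>R b) = (1 - s) *\<^sub>R P a + s *\<^sub>R P b"
        by (simp add: P_def algebra_simps)
      then show "h ((1 - s) *\<^sub>R a + s *\<^sub>R b) \<le> (1 - s) * h a + s * h b"
        using convex_onD[OF J(1)[of i x] _ _ P_in P_in, of s a b] s
        unfolding hP P_def[symmetric] by simp
    qed simp
  qed
  note line = this
  have "(\<forall>y\<in>\<Omega> i. J i x \<le> J i (with_block ow i y x)) \<longleftrightarrow>
      (\<forall>y\<in>\<Omega> i. 0 \<le> (y - block ow i x) \<bullet> partial_grad ow i (J i) x)"
    if x: "x \<in> profiles ow \<Omega>" for i
  proof (intro iffI ballI)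
    fix y assume min: "\<forall>y\<in>\<Omega> i. J i x \<le> J i (with_block ow i y x)" and y: "y \<in> \<Omega> i"
    define h where "h = (\<lambda>t. J i (with_block ow i (x + t *\<^sub>R (y - block ow i x)) x))"
    note line = line[OF y h_def]
    have h_min: "h 0 \<le> h t" if t: "0 \<le> t" "t \<le> 1" for t
    proof -
      have "block ow i x + t *\<^sub>R (y - block ow i x) = (1 - t) *\<^sub>R block ow i x + t *\<^sub>R y"
        by (simp add: algebra_simps)
      also have "\<dots> \<in> \<Omega> i"
        using \<Omega>(2)[of i] x y t by (intro convexD) (auto simp: profiles_def)
      finally have "J i x \<le> h t" unfolding line(4) using min by blast
      then show ?thesis by (simp add: h_def with_block_self)
    qed
    show "0 \<le> (y - block ow i x) \<bullet> partial_grad ow i (J i) x"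
    proof (rule ccontr)
      assume "\<not> 0 \<le> (y - block ow i x) \<bullet> partial_grad ow i (J i) x"
      then obtain d where d: "d > 0" "\<And>t. t > 0 \<Longrightarrow> t < d \<Longrightarrow> h (0 + t) < h 0"
        using DERIV_neg_dec_right[OF line(2)] by force
      \<comment> \<open>The point is within the range of strict decrease and still on the
        segment.\<close>
      have "h (min (d / 2) 1) < h 0" using d(2)[of "min (d / 2) 1"] d(1) by simp
      then show False
        using d(1) h_min[of "min (d / 2) 1"] by simp
    qed
  next
    fix y assume vi: "\<forall>y\<in>\<Omega> i. 0 \<le> (y - block ow i x) \<bullet> partial_grad ow i (J i) x"
      and y: "y \<in> \<Omega> i"
    define h where "h = (\<lambda>t. J i (with_block ow i (x + t *\<^sub>R (y - block ow i x)) x))"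
    note line = line[OF y h_def]
    have "h 1 - h 0 \<ge> ((y - block ow i x) \<bullet> partial_grad ow i (J i) x) * (1 - 0)"
      by (rule convex_on_imp_above_tangent[OF line(3)]) (use line(2) in auto)
    then show "J i x \<le> J i (with_block ow i y x)"
      unfolding line(1) using vi y by force
  qed
  then show ?thesis
    unfolding nash_equilibrium_def variational_solution_def le_INF_iff ereal_less_eq by blast
qed

section \<open>Projections, existence and uniqueness\<close>

lemma norm_diff_scaleR_sq:
  fixes a b :: "'b::real_inner"
  shows "(norm (a - t *\<^sub>R b))\<^sup>2 = (norm a)\<^sup>2 - 2 * t * (b \<bullet> a) + t\<^sup>2 * (norm b)\<^sup>2"
  unfolding power2_norm_eq_inner
  by (simp add: inner_diff_left inner_diff_right inner_commute[of a b] power2_eq_square algebra_simps)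

text \<open>Obtuse-angle criterion: the cross term in the expansion of \<open>norm (a - z)\<close>
  squared is nonnegative.\<close>

lemma closest_point_eqI:
  fixes x :: "'b::euclidean_space"
  assumes "convex S" "closed S" "x \<in> S" "\<And>z. z \<in> S \<Longrightarrow> 0 \<le> (z - x) \<bullet> (x - a)"
  shows "closest_point S a = x"
proof (rule closest_point_unique[symmetric, OF assms(1-3)], intro ballI)
  fix z assume "z \<in> S"
  have "(norm (a - z))\<^sup>2 = (norm (a - x))\<^sup>2 + (norm (z - x))\<^sup>2 + 2 * ((z - x) \<bullet> (x - a))"
    unfolding power2_norm_eq_inner by (simp add: inner_diff_left inner_diff_right inner_commute)
  also have "\<dots> \<ge> (norm (a - x))\<^sup>2" using assms(4)[OF \<open>z \<in> S\<close>] by simp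
  finally show "dist a x \<le> dist a z"
    by (simp add: dist_norm power2_le_iff_abs_le)
qed

lemma profiles_closed_convex_nonempty:
  fixes ow :: "'c::finite \<Rightarrow> 'a"
  assumes \<Omega>: "\<And>i. \<Omega> i \<subseteq> block_space ow i"
      "\<And>i. \<Omega> i \<noteq> {}" "\<And>i. closed (\<Omega> i)" "\<And>i. convex (\<Omega> i)"
  shows "closed (profiles ow \<Omega>)" "convex (profiles ow \<Omega>)" "profiles ow \<Omega> \<noteq> {}"
proof -
  have eq: "profiles ow \<Omega> = (\<Inter>i. block ow i -` \<Omega> i)" by (auto simp: profiles_def)
  show "closed (profiles ow \<Omega>)"
    unfolding eq by (intro closed_INT ballI closed_vimage \<Omega> linear_continuous_on linear_linear[THEN iffD2] linear_block)
  show "convex (profiles ow \<Omega>)"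
    unfolding eq by (intro convex_INT convex_linear_vimage linear_block \<Omega>)
  have "\<exists>y. \<forall>i. y i \<in> \<Omega> i"
    by (intro choice allI) (use \<Omega>(2) in blast)
  then obtain y where y: "\<And>i. y i \<in> \<Omega> i" by blast
  have "block ow i (\<chi> c. y (ow c) $ c) = block ow i (y i)" for i
    by (auto simp: block_def vec_eq_iff)
  also have "\<dots> i = y i" for i
    using y \<Omega>(1) by (intro block_eq_self) auto
  finally have "(\<chi> c. y (ow c) $ c) \<in> profiles ow \<Omega>"
    using y by (simp add: profiles_def)
  then show "profiles ow \<Omega> \<noteq> {}" by blast
qed

lemma ex1_variational_solution:
  fixes ow :: "'c::finite \<Rightarrow> 'a::finite"
  assumes \<Omega>: "\<And>i. \<Omega> i \<subseteq> block_space ow i"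
      "\<And>i. \<Omega> i \<noteq> {}" "\<And>i. closed (\<Omega> i)" "\<And>i. convex (\<Omega> i)"
    and mono: "\<mu> > 0"
      "\<And>x y. (pseudo_grad ow J x - pseudo_grad ow J y) \<bullet> (x - y) \<ge> \<mu> * (norm (x - y))\<^sup>2"
    and lip: "l0 > 0" "l0-lipschitz_on UNIV (pseudo_grad ow J)"
  shows "\<exists>!x. variational_solution ow \<Omega> J x"
proof (rule ex_ex1I)
  define F where "F = pseudo_grad ow J"
  note P = profiles_closed_convex_nonempty[of \<Omega> ow, OF \<Omega>]
  \<comment> \<open>Minimizes
    \<open>1 - 2 * \<gamma> * \<mu> + \<gamma>\<^sup>2 * l0\<^sup>2\<close>, the bound for the
    squared contraction factor.\<close>
  define \<gamma> where "\<gamma> = \<mu> / l0\<^sup>2"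
  define T where "T x = closest_point (profiles ow \<Omega>) (x - \<gamma> *\<^sub>R F x)" for x
  \<comment> \<open>The maximum with 0 avoids a comparison of \<open>\<mu>\<close> with
    \<open>l0\<close>.\<close>
  define c where "c = sqrt (max 0 (1 - \<mu>\<^sup>2 / l0\<^sup>2))"
  have \<gamma>: "0 < \<gamma>" using mono(1) lip(1) by (simp add: \<gamma>_def)
  have "dist (T x) (T y) \<le> c * dist x y" for x y
  proof -
    have "norm (F x - F y) \<le> l0 * norm (x - y)"
      using lipschitz_onD[OF lip(2)] by (simp add: F_def dist_norm)
    then have L: "(norm (F x - F y))\<^sup>2 \<le> l0\<^sup>2 * (norm (x - y))\<^sup>2"
      using power_mono[of _ _ 2] by (metis norm_ge_zero power_mult_distrib)
    have "(norm ((x - \<gamma> *\<^sub>R F x) - (y - \<gamma> *\<^sub>R F y)))\<^sup>2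
        = (norm ((x - y) - \<gamma> *\<^sub>R (F x - F y)))\<^sup>2"
      by (simp add: algebra_simps)
    also have "\<dots> = (norm (x - y))\<^sup>2 - 2 * \<gamma> * ((F x - F y) \<bullet> (x - y))
        + \<gamma>\<^sup>2 * (norm (F x - F y))\<^sup>2"
      by (rule norm_diff_scaleR_sq)
    also have "\<dots> \<le> (norm (x - y))\<^sup>2 - 2 * \<gamma> * (\<mu> * (norm (x - y))\<^sup>2)
        + \<gamma>\<^sup>2 * (l0\<^sup>2 * (norm (x - y))\<^sup>2)"
    proof (intro add_mono diff_mono order_refl)
      show "2 * \<gamma> * (\<mu> * (norm (x - y))\<^sup>2) \<le> 2 * \<gamma> * ((F x - F y) \<bullet> (x - y))"
        unfolding F_def using \<gamma> by (intro mult_left_mono mono(2)) simp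
      show "\<gamma>\<^sup>2 * (norm (F x - F y))\<^sup>2 \<le> \<gamma>\<^sup>2 * (l0\<^sup>2 * (norm (x - y))\<^sup>2)"
        by (intro mult_left_mono L) simp
    qed
    also have "\<dots> = (1 - \<mu>\<^sup>2 / l0\<^sup>2) * (norm (x - y))\<^sup>2"
      using lip(1) by (simp add: \<gamma>_def field_simps power2_eq_square)
    also have "\<dots> \<le> max 0 (1 - \<mu>\<^sup>2 / l0\<^sup>2) * (norm (x - y))\<^sup>2"
      by (intro mult_right_mono) auto
    also have "\<dots> = (c * norm (x - y))\<^sup>2"
      by (simp add: c_def power_mult_distrib)
    finally have "norm ((x - \<gamma> *\<^sub>R F x) - (y - \<gamma> *\<^sub>R F y)) \<le> c * norm (x - y)"
      by (rule power2_le_imp_le) (simp add: c_def)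
    moreover have "dist (T x) (T y) \<le> dist (x - \<gamma> *\<^sub>R F x) (y - \<gamma> *\<^sub>R F y)"
      unfolding T_def by (intro closest_point_lipschitz P)
    ultimately show ?thesis by (simp add: dist_norm)
  qed
  moreover have "0 \<le> c" "c < 1"
    using mono(1) lip(1) by (auto simp: c_def max_def)
  ultimately obtain x where x: "T x = x"
    using banach_fix_type[of c T] by blast
  have xP: "x \<in> profiles ow \<Omega>"
    using closest_point_in_set[OF P(1,3), of "x - \<gamma> *\<^sub>R F x"] x by (simp add: T_def)
  have "0 \<le> (y - block ow i x) \<bullet> partial_grad ow i (J i) x" if y: "y \<in> \<Omega> i" for i y
  proof -
    \<comment> \<open>A unilateral deviation: testing the projection inequality at \<open>z\<close>
      isolates the term of agent \<open>i\<close>.\<close>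
    define z where "z = with_block ow i y x"
    have "block ow j z = (if j = i then block ow i y else block ow j x)" for j
      by (auto simp: z_def block_def with_block_def vec_eq_iff)
    moreover have yb: "block ow i y = y" using y \<Omega>(1) by (intro block_eq_self) auto
    ultimately have bz: "block ow j z = (if j = i then y else block ow j x)" for j by simp
    then have "z \<in> profiles ow \<Omega>" using xP y by (auto simp: profiles_def)
    from closest_point_dot[OF P(2,1) this, of "x - \<gamma> *\<^sub>R F x"]
    have "0 \<le> F x \<bullet> (z - x)" using x \<gamma> by (simp add: T_def zero_le_mult_iff)
    also have "\<dots> = (\<Sum>j\<in>UNIV. if j = i then partial_grad ow i (J i) x \<bullet> (y - block ow i x) else 0)"
      unfolding F_def pseudo_grad_dot by (intro sum.cong) (auto simp: block_diff bz)
    finally show ?thesis by (simp add: inner_commute)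
  qed
  then show "\<exists>x. variational_solution ow \<Omega> J x"
    using xP by (auto simp: variational_solution_def)
next
  \<comment> \<open>Each solution is a competitor in the inequality of the other; adding both
    inequalities confronts them with strong monotonicity.\<close>
  have dot: "0 \<le> pseudo_grad ow J x \<bullet> (y - x)"
    if "variational_solution ow \<Omega> J x" "variational_solution ow \<Omega> J y" for x y
    unfolding pseudo_grad_dot block_diff
  proof (rule sum_nonneg)
    fix i
    have "block ow i y \<in> \<Omega> i"
      using that(2) by (simp add: variational_solution_def profiles_def)
    then have "0 \<le> (block ow i y - block ow i x) \<bullet> partial_grad ow i (J i) x"
      using that(1) unfolding variational_solution_def by blast
    then show "0 \<le> partial_grad ow i (J i) x \<bullet> (block ow i y - block ow i x)"
      by (subst inner_commute)
  qed
  fix x y assume xy: "variational_solution ow \<Omega> J x" "variational_solution ow \<Omega> J y"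
  have "\<mu> * (norm (x - y))\<^sup>2 \<le> 0"
  proof -
    have "(pseudo_grad ow J x - pseudo_grad ow J y) \<bullet> (x - y)
        = - (pseudo_grad ow J x \<bullet> (y - x)) - pseudo_grad ow J y \<bullet> (x - y)"
      by (simp add: inner_diff_left inner_diff_right)
    then show ?thesis
      using mono(2)[of x y] dot[OF xy] dot[OF xy(2,1)] by linarith
  qed
  then show "x = y" using mono(1) by (simp add: mult_le_0_iff)
qed

text \<open>The obtuse-angle criterion here is \<open>t\<close> times the variational inequality.
  Any nonnegative step is allowed, so each agent can use its own
  \<open>\<alpha> / q $ i\<close>.\<close>

lemma variational_solution_fixed_point:
  assumes \<Omega>: "closed (\<Omega> i)" "convex (\<Omega> i)"
    and "variational_solution ow \<Omega> J x" "0 \<le> t"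
  shows "closest_point (\<Omega> i) (block ow i x - t *\<^sub>R partial_grad ow i (J i) x) = block ow i x"
proof (rule closest_point_eqI[OF \<Omega>(2,1)])
  show "block ow i x \<in> \<Omega> i"
    using assms(3) by (simp add: variational_solution_def profiles_def)
next
  fix z assume "z \<in> \<Omega> i"
  then have "0 \<le> (z - block ow i x) \<bullet> partial_grad ow i (J i) x"
    using assms(3) unfolding variational_solution_def by blast
  then show "0 \<le> (z - block ow i x) \<bullet> (block ow i x - (block ow i x - t *\<^sub>R partial_grad ow i (J i) x))"
    using assms(4) by simp
qed

section \<open>One step of the algorithm\<close>

text \<open>\<open>matrix_inv\<close> chooses some two-sided inverse, so one has to be exhibited
  before its entries can be computed.\<close>

lemma matrix_inv_diag:
  assumes "\<And>i. d $ i \<noteq> 0"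
  shows "matrix_inv (diag d) = diag (\<chi> i. 1 / d $ i)"
proof -
  define D where "D = diag (\<chi> i. 1 / d $ i)"
  have D: "diag d ** D = mat 1" "D ** diag d = mat 1"
    using assms by (simp_all add: D_def matrix_eq matrix_vector_mul_assoc[symmetric] diag_mult_vec
        vec_eq_iff)
  then have "diag d ** matrix_inv (diag d) = mat 1"
    unfolding matrix_inv_def by (rule_tac someI2[of _ D]) auto
  then have "D ** (diag d ** matrix_inv (diag d)) = D" by simp
  then show ?thesis unfolding matrix_mul_assoc D by (simp add: D_def)
qed

lemma norm_vec_sq: "(norm x)\<^sup>2 = (\<Sum>c\<in>UNIV. (x $ c)\<^sup>2)" for x :: "real^'c"
  unfolding power2_norm_eq_inner by (simp add: inner_vec_def power2_eq_square)

lemma wnorm_diag_sq: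
  assumes "\<And>i. 0 \<le> d $ i"
  shows "(wnorm (diag d) x)\<^sup>2 = (\<Sum>i\<in>UNIV. d $ i * (x $ i)\<^sup>2)" "0 \<le> wnorm (diag d) x"
proof -
  have "winner (diag d) x x = (\<Sum>i\<in>UNIV. d $ i * (x $ i)\<^sup>2)"
    by (simp add: winner_def diag_mult_vec inner_vec_def power2_eq_square mult_ac)
  moreover have "0 \<le> (\<Sum>i\<in>UNIV. d $ i * (x $ i)\<^sup>2)"
    using assms by (intro sum_nonneg) simp
  ultimately show "(wnorm (diag d) x)\<^sup>2 = (\<Sum>i\<in>UNIV. d $ i * (x $ i)\<^sup>2)" "0 \<le> wnorm (diag d) x"
    by (simp_all add: wnorm_def)
qed

lemma Qbold_mat_diag:
  "(Qbold_mat q :: real^('a::finite \<times> 'c::finite)^('a \<times> 'c)) = diag (\<chi> p. q $ fst p)"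
  by (simp add: Qbold_mat_def Q_mat_def kron_mat_def diag_def mat_def vec_eq_iff prod_eq_iff)

lemma wnorm_Qbold_sq:
  fixes X :: "real^('a::finite \<times> 'c::finite)"
  assumes "\<And>i. 0 < q $ i"
  shows "(wnorm (Qbold_mat q) X)\<^sup>2 = (\<Sum>i\<in>UNIV. q $ i * (norm (est X i))\<^sup>2)"
    "0 \<le> wnorm (Qbold_mat q) X"
proof -
  have "(wnorm (Qbold_mat q) X)\<^sup>2 = (\<Sum>p\<in>UNIV. q $ fst p * (X $ p)\<^sup>2)"
    unfolding Qbold_mat_diag using assms by (subst wnorm_diag_sq) (auto intro: less_imp_le)
  also have "\<dots> = (\<Sum>i\<in>UNIV. \<Sum>c\<in>UNIV. q $ i * (X $ (i, c))\<^sup>2)"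
    by (simp add: UNIV_Times_UNIV[symmetric] sum.cartesian_product split_beta del: UNIV_Times_UNIV)
  finally show "(wnorm (Qbold_mat q) X)\<^sup>2 = (\<Sum>i\<in>UNIV. q $ i * (norm (est X i))\<^sup>2)"
    by (simp add: norm_vec_sq est_def sum_distrib_left)
  show "0 \<le> wnorm (Qbold_mat q) X"
    unfolding Qbold_mat_diag using assms by (intro wnorm_diag_sq) (auto intro: less_imp_le)
qed

lemma est_diff: "est (X - Y) i = est X i - est Y i"
  by (simp add: est_def vec_eq_iff)

lemma est_kron_vec_ones: "est (kron_vec (\<chi> i. 1) s) i = s"
  by (simp add: est_def kron_vec_def vec_eq_iff)

section \<open>Consensus and disagreement\<close>

text \<open>Bias-variance decomposition: the weights sum to 1 and \<open>y\<close> is the weighted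
  mean, so the cross term vanishes.\<close>

lemma consensus_pythagoras:
  fixes z :: "'a::finite \<Rightarrow> 'b::real_inner"
  assumes q: "(\<Sum>i\<in>UNIV. q $ i) = 1" and y: "(\<Sum>i\<in>UNIV. q $ i *\<^sub>R z i) = y"
  shows "(\<Sum>i\<in>UNIV. q $ i * (norm (z i - s))\<^sup>2)
    = (norm (y - s))\<^sup>2 + (\<Sum>i\<in>UNIV. q $ i * (norm (z i - y))\<^sup>2)"
proof -
  have "q $ i * (norm (z i - s))\<^sup>2 = q $ i * (norm (z i - y))\<^sup>2
      + 2 * ((q $ i *\<^sub>R z i) \<bullet> (y - s)) - q $ i * (2 * (y \<bullet> (y - s))) + q $ i * (norm (y - s))\<^sup>2" for i
    unfolding power2_norm_eq_inner
    by (simp add: inner_diff_left inner_diff_right inner_commute[of y "z i"] inner_commute[of s "z i"]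
        inner_commute[of s y] algebra_simps)
  then have "(\<Sum>i\<in>UNIV. q $ i * (norm (z i - s))\<^sup>2) = (\<Sum>i\<in>UNIV. q $ i * (norm (z i - y))\<^sup>2)
      + 2 * ((\<Sum>i\<in>UNIV. q $ i *\<^sub>R z i) \<bullet> (y - s))
      - (\<Sum>i\<in>UNIV. q $ i) * (2 * (y \<bullet> (y - s))) + (\<Sum>i\<in>UNIV. q $ i) * (norm (y - s))\<^sup>2"
    by (simp only: sum.distrib sum_subtractf sum_distrib_left sum_distrib_right inner_sum_left)
  then show ?thesis unfolding q y by simp
qed

text \<open>The scalar contraction applies to each coordinate \<open>c\<close> separately:
  \<open>x c\<close> collects the disagreements of all agents there and has weighted mean
  zero.\<close>

lemma mixing_contraction:
  fixes W :: "real^'a^'a" and z :: "'a \<Rightarrow> real^'c"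
  assumes agents: "2 \<le> CARD('a)"
    and W: "\<And>i j. 0 \<le> W $ i $ j" "W *v (\<chi> i. 1) = (\<chi> i. 1)"
    and q: "\<And>i. 0 < q $ i" "q v* W = q" "(\<Sum>i\<in>UNIV. q $ i) = 1"
    and y: "(\<Sum>i\<in>UNIV. q $ i *\<^sub>R z i) = y"
  shows "(\<Sum>i\<in>UNIV. q $ i * (norm ((\<Sum>j\<in>UNIV. W $ i $ j *\<^sub>R z j) - y))\<^sup>2)
    \<le> (sigma_bar W q)\<^sup>2 * (\<Sum>i\<in>UNIV. q $ i * (norm (z i - y))\<^sup>2)"
proof -
  define x where "x c = (\<chi> i. z i $ c - y $ c)" for c
  have W1: "(\<Sum>j\<in>UNIV. W $ i $ j) = 1" for i
    using arg_cong[OF W(2), of "\<lambda>z. z $ i"] by (simp add: matrix_vector_mult_def)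
  have Wx: "((\<Sum>j\<in>UNIV. W $ i $ j *\<^sub>R z j) - y) $ c = (W *v x c) $ i" for i c
    by (simp add: x_def matrix_vector_mult_def right_diff_distrib sum_subtractf
        sum_distrib_right[symmetric] W1)
  have "(\<Sum>i\<in>UNIV. q $ i * x c $ i) = 0" for c
    using arg_cong[OF y, of "\<lambda>v. v $ c"]
    by (simp add: x_def right_diff_distrib sum_subtractf sum_distrib_right[symmetric] q(3))
  then have le: "(\<Sum>i\<in>UNIV. q $ i * ((W *v x c) $ i)\<^sup>2)
      \<le> (sigma_bar W q)\<^sup>2 * (\<Sum>i\<in>UNIV. q $ i * (x c $ i)\<^sup>2)" for c
    by (intro sigma_bar_contraction(2)[OF agents W q(1,2)])
  have "(\<Sum>i\<in>UNIV. q $ i * (norm ((\<Sum>j\<in>UNIV. W $ i $ j *\<^sub>R z j) - y))\<^sup>2)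
      = (\<Sum>c\<in>UNIV. \<Sum>i\<in>UNIV. q $ i * ((W *v x c) $ i)\<^sup>2)"
    unfolding norm_vec_sq Wx sum_distrib_left by (rule sum.swap)
  also have "\<dots> \<le> (\<Sum>c\<in>UNIV. (sigma_bar W q)\<^sup>2 * (\<Sum>i\<in>UNIV. q $ i * (x c $ i)\<^sup>2))"
    by (rule sum_mono[OF le])
  also have "\<dots> = (sigma_bar W q)\<^sup>2 * (\<Sum>i\<in>UNIV. q $ i * (norm (z i - y))\<^sup>2)"
    unfolding norm_vec_sq sum_distrib_left
    by (subst sum.swap) (simp add: x_def)
  finally show ?thesis .
qed

text \<open>Gradient differences are measured with the dual weights \<open>1 / w c\<close>,
  displacements with \<open>w c\<close>; the roots of the weights cancel in the product.\<close>

lemma weighted_Cauchy_Schwarz: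
  fixes w u d :: "'c \<Rightarrow> real"
  assumes w: "\<And>c. 0 < w c" and u: "(\<Sum>c\<in>A. (u c)\<^sup>2 / w c) \<le> P\<^sup>2" and d: "(\<Sum>c\<in>A. w c * (d c)\<^sup>2) \<le> R\<^sup>2"
    and PR: "0 \<le> P" "0 \<le> R"
  shows "\<bar>\<Sum>c\<in>A. u c * d c\<bar> \<le> P * R"
proof -
  have sq: "u c * d c = (u c / sqrt (w c)) * (sqrt (w c) * d c)"
    "(u c / sqrt (w c))\<^sup>2 = (u c)\<^sup>2 / w c" "(sqrt (w c) * d c)\<^sup>2 = w c * (d c)\<^sup>2" for c
    using w[of c] by (simp_all add: power_divide power_mult_distrib)
  have "(\<Sum>c\<in>A. u c * d c)\<^sup>2 \<le> (\<Sum>c\<in>A. (u c)\<^sup>2 / w c) * (\<Sum>c\<in>A. w c * (d c)\<^sup>2)"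
    unfolding sq(1) sq(2,3)[symmetric] by (rule Cauchy_Schwarz_ineq_sum)
  also have "\<dots> \<le> P\<^sup>2 * R\<^sup>2"
    using u d by (intro mult_mono sum_nonneg) (simp_all add: less_imp_le[OF w])
  finally have "\<bar>\<Sum>c\<in>A. u c * d c\<bar>\<^sup>2 \<le> (P * R)\<^sup>2" by (simp add: power_mult_distrib)
  then show ?thesis using PR by (rule_tac power2_le_imp_le) simp_all
qed

lemma owned_coordinates_le:
  fixes ow :: "'c::finite \<Rightarrow> 'a::finite"
  assumes "\<And>i. 0 < q $ i"
  shows "(\<Sum>c\<in>UNIV. q $ ow c * (D (ow c) $ c)\<^sup>2) \<le> (\<Sum>i\<in>UNIV. q $ i * (norm (D i))\<^sup>2)"
proof -
  have "(\<Sum>c\<in>UNIV. q $ ow c * (D (ow c) $ c)\<^sup>2)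
      = (\<Sum>i\<in>UNIV. \<Sum>c\<in>UNIV. if ow c = i then q $ i * (D i $ c)\<^sup>2 else 0)"
    by (simp add: sum_over_owners)
  also have "\<dots> \<le> (\<Sum>i\<in>UNIV. \<Sum>c\<in>UNIV. q $ i * (D i $ c)\<^sup>2)"
    by (intro sum_mono) (simp add: less_imp_le[OF assms])
  finally show ?thesis by (simp add: norm_vec_sq sum_distrib_left)
qed

text \<open>The bound splits both factors at the consensus average \<open>y\<close>: only the gradient difference along
  the consensus line is monotone, the three other products are controlled by Cauchy--Schwarz.\<close>

lemma extended_gradient_dot_lower_bound:
  fixes ow :: "'c::finite \<Rightarrow> 'a::finite" and G :: "('a \<Rightarrow> real^'c) \<Rightarrow> real^'c"
  assumes q: "\<And>i. 0 < q $ i" "(\<Sum>i\<in>UNIV. q $ i) = 1"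
    and lip: "0 \<le> l" "\<And>Y Z. (\<Sum>c\<in>UNIV. (G Y $ c - G Z $ c)\<^sup>2 / q $ ow c)
        \<le> l\<^sup>2 * (\<Sum>i\<in>UNIV. q $ i * (norm (Y i - Z i))\<^sup>2)"
    and mono: "0 \<le> \<mu>" "\<And>x y. \<mu> * (\<Sum>c\<in>UNIV. q $ ow c * ((x - y) $ c)\<^sup>2)
        \<le> (G (\<lambda>_. x) - G (\<lambda>_. y)) \<bullet> (x - y)"
    and qmin: "\<And>i. qmin \<le> q $ i"
    and A: "A = norm (y - s)"
    and B: "0 \<le> B" "B\<^sup>2 = (\<Sum>i\<in>UNIV. q $ i * (norm (Y i - y))\<^sup>2)"
  shows "\<mu> * qmin * A\<^sup>2 - 2 * l * A * B - l * B\<^sup>2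
    \<le> (\<Sum>c\<in>UNIV. (G Y $ c - G (\<lambda>_. s) $ c) * (Y (ow c) - s) $ c)"
proof -
  define u where "u c = G Y $ c - G (\<lambda>_. y) $ c" for c
  define v where "v c = G (\<lambda>_. y) $ c - G (\<lambda>_. s) $ c" for c
  have A0: "0 \<le> A" by (simp add: A)
  have u: "(\<Sum>c\<in>UNIV. (u c)\<^sup>2 / q $ ow c) \<le> (l * B)\<^sup>2"
    using lip(2)[of Y "\<lambda>_. y"] by (simp add: u_def power_mult_distrib B(2))
  \<comment> \<open>For constant families the weights add up to 1, so the Lipschitz bound involves
    just \<open>A\<close>.\<close>
  have v: "(\<Sum>c\<in>UNIV. (v c)\<^sup>2 / q $ ow c) \<le> (l * A)\<^sup>2"
    using lip(2)[of "\<lambda>_. y" "\<lambda>_. s"]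
    by (simp add: v_def power_mult_distrib A sum_distrib_right[symmetric] q(2))
  have dB: "(\<Sum>c\<in>UNIV. q $ ow c * ((Y (ow c) - y) $ c)\<^sup>2) \<le> B\<^sup>2"
    unfolding B(2) by (rule owned_coordinates_le[OF q(1)])
  have dA: "(\<Sum>c\<in>UNIV. q $ ow c * ((y - s) $ c)\<^sup>2) \<le> A\<^sup>2"
    using owned_coordinates_le[OF q(1), of ow "\<lambda>_. y - s"]
    by (simp add: A sum_distrib_right[symmetric] q(2))
  note CS = weighted_Cauchy_Schwarz[of "\<lambda>c. q $ ow c", OF q(1)]
  have lA: "0 \<le> l * A" and lB: "0 \<le> l * B" using lip(1) A0 B(1) by simp_all
  have 1: "\<bar>\<Sum>c\<in>UNIV. u c * (Y (ow c) - y) $ c\<bar> \<le> (l * B) * B"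
    by (rule CS[OF u dB lB B(1)])
  have 2: "\<bar>\<Sum>c\<in>UNIV. u c * (y - s) $ c\<bar> \<le> (l * B) * A"
    by (rule CS[OF u dA lB A0])
  have 3: "\<bar>\<Sum>c\<in>UNIV. v c * (Y (ow c) - y) $ c\<bar> \<le> (l * A) * B"
    by (rule CS[OF v dB lA B(1)])
  \<comment> \<open>Monotonicity sees the consensus error only through the weights of the owners;
    this is the origin of \<open>lambda_min (Q_mat q)\<close> in the matrix.\<close>
  have "qmin * A\<^sup>2 \<le> (\<Sum>c\<in>UNIV. q $ ow c * ((y - s) $ c)\<^sup>2)"
    unfolding A norm_vec_sq sum_distrib_left by (intro sum_mono mult_right_mono qmin) simp
  then have "\<mu> * (qmin * A\<^sup>2) \<le> \<mu> * (\<Sum>c\<in>UNIV. q $ ow c * ((y - s) $ c)\<^sup>2)"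
    by (rule mult_left_mono[OF _ mono(1)])
  also have "\<dots> \<le> (\<Sum>c\<in>UNIV. v c * (y - s) $ c)"
    using mono(2)[of y s] by (simp add: inner_vec_def v_def)
  finally have 4: "\<mu> * (qmin * A\<^sup>2) \<le> (\<Sum>c\<in>UNIV. v c * (y - s) $ c)" .
  have "(\<Sum>c\<in>UNIV. (G Y $ c - G (\<lambda>_. s) $ c) * (Y (ow c) - s) $ c)
      = (\<Sum>c\<in>UNIV. u c * (Y (ow c) - y) $ c + u c * (y - s) $ c
          + v c * (Y (ow c) - y) $ c + v c * (y - s) $ c)"
    by (intro sum.cong refl) (simp add: u_def v_def algebra_simps)
  also have "\<dots> = (\<Sum>c\<in>UNIV. u c * (Y (ow c) - y) $ c) + (\<Sum>c\<in>UNIV. u c * (y - s) $ c)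
      + (\<Sum>c\<in>UNIV. v c * (Y (ow c) - y) $ c) + (\<Sum>c\<in>UNIV. v c * (y - s) $ c)"
    by (simp only: sum.distrib)
  also have "\<dots> \<ge> - (l * B * B) - l * B * A - l * A * B + \<mu> * (qmin * A\<^sup>2)"
    using 1 2 3 4 by linarith
  finally show ?thesis by (simp add: algebra_simps power2_eq_square)
qed

section \<open>The projected gradient step in the weighted norm\<close>

lemma norm_block_split: "(norm z)\<^sup>2 = (norm (block ow i z))\<^sup>2 + (norm (z - block ow i z))\<^sup>2"
  unfolding norm_vec_sq sum.distrib[symmetric]
  by (intro sum.cong refl) (simp add: block_def)

text \<open>On block \<open>i\<close> the projection is nonexpansive; off the block both gradients
  vanish and \<open>a\<close> agrees with \<open>Y\<close>, so the two errors coincide there.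
  Pythagoras joins the two parts.\<close>

lemma block_projection_step:
  assumes S: "closed S" "convex S" "S \<noteq> {}"
    and g: "block ow i g = g" "block ow i h = h"
    and s: "block ow i s = closest_point S (block ow i s - t *\<^sub>R h)"
    and a: "block ow i a = closest_point S (block ow i Y - t *\<^sub>R g)"
      "\<And>c. ow c \<noteq> i \<Longrightarrow> a $ c = Y $ c"
  shows "(norm (a - s))\<^sup>2 \<le> (norm ((Y - s) - t *\<^sub>R (g - h)))\<^sup>2"
proof -
  define w where "w = (Y - s) - t *\<^sub>R (g - h)"
  have "dist (block ow i a) (block ow i s) \<le> dist (block ow i Y - t *\<^sub>R g) (block ow i s - t *\<^sub>R h)"
    by (subst a(1), subst s) (rule closest_point_lipschitz[OF S(2,1,3)])
  also have "\<dots> = norm (block ow i w)"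
    unfolding dist_norm w_def block_diff block_scaleR g
    by (simp add: scaleR_diff_right algebra_simps)
  finally have "norm (block ow i (a - s)) \<le> norm (block ow i w)"
    by (simp add: dist_norm block_diff)
  moreover have "(a - s) - block ow i (a - s) = w - block ow i w"
  proof -
    have "(g - h) $ c = 0" if "ow c \<noteq> i" for c
      using arg_cong[OF g(1), of "\<lambda>v. v $ c"] arg_cong[OF g(2), of "\<lambda>v. v $ c"] that
      by (simp add: block_def)
    then show ?thesis using a(2) by (auto simp: vec_eq_iff block_def w_def)
  qed
  ultimately show ?thesis
    unfolding w_def[symmetric] norm_block_split[of "a - s" ow i] norm_block_split[of w ow i]
    by (intro add_mono power_mono) simp_all
qed

text \<open>The weight \<open>q $ i\<close> meets the step \<open>\<alpha> / q $ i\<close>: it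
  cancels in the cross term and leaves \<open>1 / q $ i\<close> in the quadratic term, which is the
  dual weight of the Lipschitz bound.\<close>

lemma projected_gradient_step:
  fixes ow :: "'c::finite \<Rightarrow> 'a::finite"
  assumes q: "\<And>i. 0 < q $ i"
    and S: "\<And>i. closed (S i)" "\<And>i. convex (S i)" "\<And>i. S i \<noteq> {}"
    and g: "\<And>i. block ow i (g i) = g i" "\<And>i. block ow i (h i) = h i"
    and s: "\<And>i. block ow i s = closest_point (S i) (block ow i s - (\<alpha> / q $ i) *\<^sub>R h i)"
    and a: "\<And>i. block ow i (a i) = closest_point (S i) (block ow i (Y i) - (\<alpha> / q $ i) *\<^sub>R g i)"
      "\<And>i c. ow c \<noteq> i \<Longrightarrow> a i $ c = Y i $ c"
  shows "(\<Sum>i\<in>UNIV. q $ i * (norm (a i - s))\<^sup>2) \<le> (\<Sum>i\<in>UNIV. q $ i * (norm (Y i - s))\<^sup>2)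
    - 2 * \<alpha> * (\<Sum>c\<in>UNIV. (g (ow c) $ c - h (ow c) $ c) * (Y (ow c) - s) $ c)
    + \<alpha>\<^sup>2 * (\<Sum>c\<in>UNIV. (g (ow c) $ c - h (ow c) $ c)\<^sup>2 / q $ ow c)"
proof -
  define \<delta> where "\<delta> i = g i - h i" for i
  have \<delta>: "block ow i (\<delta> i) = \<delta> i" for i by (simp add: \<delta>_def block_diff g)
  have "q $ i * (norm (a i - s))\<^sup>2 \<le> q $ i * (norm (Y i - s))\<^sup>2
      - 2 * \<alpha> * (\<delta> i \<bullet> (Y i - s)) + \<alpha>\<^sup>2 * ((\<delta> i \<bullet> \<delta> i) / q $ i)" for i
  proof -
    have "q $ i * (norm (a i - s))\<^sup>2 \<le> q $ i * (norm ((Y i - s) - (\<alpha> / q $ i) *\<^sub>R \<delta> i))\<^sup>2"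
      unfolding \<delta>_def using q[of i]
      by (intro mult_left_mono block_projection_step[OF S g s a]) auto
    also have "\<dots> = q $ i * (norm (Y i - s))\<^sup>2
      - 2 * \<alpha> * (\<delta> i \<bullet> (Y i - s)) + \<alpha>\<^sup>2 * ((\<delta> i \<bullet> \<delta> i) / q $ i)"
      unfolding norm_diff_scaleR_sq power2_norm_eq_inner[of "\<delta> i"]
      using q[of i] by (simp add: field_simps power2_eq_square)
    finally show ?thesis .
  qed
  then have "(\<Sum>i\<in>UNIV. q $ i * (norm (a i - s))\<^sup>2) \<le> (\<Sum>i\<in>UNIV. q $ i * (norm (Y i - s))\<^sup>2
      - 2 * \<alpha> * (\<delta> i \<bullet> (Y i - s)) + \<alpha>\<^sup>2 * ((\<delta> i \<bullet> \<delta> i) / q $ i))"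
    by (rule sum_mono)
  also have "\<dots> = (\<Sum>i\<in>UNIV. q $ i * (norm (Y i - s))\<^sup>2)
      - 2 * \<alpha> * (\<Sum>i\<in>UNIV. \<delta> i \<bullet> (Y i - s)) + \<alpha>\<^sup>2 * (\<Sum>i\<in>UNIV. (\<delta> i \<bullet> \<delta> i) / q $ i)"
    by (simp only: sum.distrib sum_subtractf sum_distrib_left)
  also have "(\<Sum>i\<in>UNIV. \<delta> i \<bullet> (Y i - s)) = (\<Sum>c\<in>UNIV. \<delta> (ow c) $ c * (Y (ow c) - s) $ c)"
    by (subst \<delta>[symmetric]) (simp only: block_dot sum_over_owners)
  also have "(\<Sum>i\<in>UNIV. (\<delta> i \<bullet> \<delta> i) / q $ i) = (\<Sum>c\<in>UNIV. (\<delta> (ow c) $ c)\<^sup>2 / q $ ow c)"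
  proof -
    have "(\<delta> i \<bullet> \<delta> i) / q $ i = (\<Sum>c\<in>UNIV. if ow c = i then (\<delta> i $ c)\<^sup>2 / q $ i else 0)" for i
      by (subst \<delta>[symmetric])
        (simp add: block_dot sum_divide_distrib power2_eq_square if_distrib[of "\<lambda>x. x / _"] cong: if_cong)
    then show ?thesis by (simp only: sum_over_owners)
  qed
  finally show ?thesis by (simp add: \<delta>_def)
qed

section \<open>The quadratic form of \<open>M_mat\<close> and the contraction\<close>

lemma M_mat_entries:
  "M_mat \<alpha> \<mu>b l W q $ 1 $ 1 = 1 - 2 * \<alpha> * \<mu>b * lambda_min (Q_mat q) + \<alpha>\<^sup>2 * l\<^sup>2"
  "M_mat \<alpha> \<mu>b l W q $ 1 $ 2 = 2 * \<alpha> * l * sigma_bar W q"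
  "M_mat \<alpha> \<mu>b l W q $ 2 $ 1 = 2 * \<alpha> * l * sigma_bar W q"
  "M_mat \<alpha> \<mu>b l W q $ 2 $ 2 = (1 + 2 * \<alpha> * l + \<alpha>\<^sup>2 * l\<^sup>2) * (sigma_bar W q)\<^sup>2"
  by (simp_all add: M_mat_def Let_def)

lemma transpose_M_mat: "transpose (M_mat \<alpha> \<mu>b l W q) = M_mat \<alpha> \<mu>b l W q"
  by (simp add: vec_eq_iff transpose_def forall_2 M_mat_entries)

text \<open>The entries absorb \<open>sigma_bar W q\<close>, turning a form in \<open>A\<close> and
  \<open>sigma_bar W q * e\<close> into one in \<open>A\<close> and \<open>e\<close>, to which the
  Rayleigh bound applies.\<close>

lemma M_mat_quadratic_form_le:
  "(1 - 2 * \<alpha> * \<mu>b * lambda_min (Q_mat q) + \<alpha>\<^sup>2 * l\<^sup>2) * A\<^sup>2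
    + 4 * \<alpha> * l * A * (sigma_bar W q * e)
    + (1 + 2 * \<alpha> * l + \<alpha>\<^sup>2 * l\<^sup>2) * (sigma_bar W q * e)\<^sup>2
    \<le> lambda_max (M_mat \<alpha> \<mu>b l W q) * (A\<^sup>2 + e\<^sup>2)"
proof -
  define v :: "real^2" where "v = vector [A, e]"
  have v: "v $ 1 = A" "v $ 2 = e" by (simp_all add: v_def)
  have "v \<bullet> (M_mat \<alpha> \<mu>b l W q *v v) \<le> lambda_max (M_mat \<alpha> \<mu>b l W q) * (v \<bullet> v)"
    using lambda_max_eigenvalue[OF transpose_M_mat[of \<alpha> \<mu>b l W q]] by blast
  then show ?thesis
    unfolding inner_vec_def sum_2 matrix_vector_mult_2 v inner_real_def M_mat_entries
    by (simp add: algebra_simps power2_eq_square)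
qed

text \<open>Here \<open>z\<close> holds the estimates before mixing, \<open>Y\<close> those after it
  and \<open>a\<close> the next iterate; \<open>G\<close> is the extended pseudo-gradient as a
  function of the family of estimates.\<close>

lemma contraction_step:
  fixes ow :: "'c::finite \<Rightarrow> 'a::finite" and G :: "('a \<Rightarrow> real^'c) \<Rightarrow> real^'c"
  assumes agents: "2 \<le> CARD('a)"
    and W: "\<And>i j. 0 \<le> W $ i $ j" "W *v (\<chi> i. 1) = (\<chi> i. 1)"
    and q: "\<And>i. 0 < q $ i" "q v* W = q" "(\<Sum>i\<in>UNIV. q $ i) = 1"
    and lip: "0 \<le> l" "\<And>Y Z. (\<Sum>c\<in>UNIV. (G Y $ c - G Z $ c)\<^sup>2 / q $ ow c)
        \<le> l\<^sup>2 * (\<Sum>i\<in>UNIV. q $ i * (norm (Y i - Z i))\<^sup>2)"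
    and mono: "0 \<le> \<mu>b" "\<And>x y. \<mu>b * (\<Sum>c\<in>UNIV. q $ ow c * ((x - y) $ c)\<^sup>2)
        \<le> (G (\<lambda>_. x) - G (\<lambda>_. y)) \<bullet> (x - y)"
    and S: "\<And>i. closed (S i)" "\<And>i. convex (S i)" "\<And>i. S i \<noteq> {}"
    and g: "\<And>i x. block ow i (g i x) = g i x" "\<And>Y c. G Y $ c = g (ow c) (Y (ow c)) $ c"
    and \<alpha>: "0 \<le> \<alpha>"
    and s: "\<And>i. block ow i s = closest_point (S i) (block ow i s - (\<alpha> / q $ i) *\<^sub>R g i s)"
    and Y: "\<And>i. Y i = (\<Sum>j\<in>UNIV. W $ i $ j *\<^sub>R z j)"
    and a: "\<And>i. block ow i (a i) = closest_point (S i) (block ow i (Y i) - (\<alpha> / q $ i) *\<^sub>R g i (Y i))"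
      "\<And>i c. ow c \<noteq> i \<Longrightarrow> a i $ c = Y i $ c"
  shows "(\<Sum>i\<in>UNIV. q $ i * (norm (a i - s))\<^sup>2)
    \<le> lambda_max (M_mat \<alpha> \<mu>b l W q) * (\<Sum>i\<in>UNIV. q $ i * (norm (z i - s))\<^sup>2)"
proof -
  define y where "y = (\<Sum>i\<in>UNIV. q $ i *\<^sub>R z i)"
  define A where "A = norm (y - s)"
  define B where "B = sqrt (\<Sum>i\<in>UNIV. q $ i * (norm (Y i - y))\<^sup>2)"
  define e where "e = sqrt (\<Sum>i\<in>UNIV. q $ i * (norm (z i - y))\<^sup>2)"
  define \<sigma> where "\<sigma> = sigma_bar W q"
  define qm where "qm = lambda_min (Q_mat q)"
  have nonneg: "0 \<le> (\<Sum>i\<in>UNIV. q $ i * (norm (f i))\<^sup>2)" for f :: "'a \<Rightarrow> real^'c"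
    by (intro sum_nonneg) (simp add: less_imp_le[OF q(1)])
  have B: "0 \<le> B" "B\<^sup>2 = (\<Sum>i\<in>UNIV. q $ i * (norm (Y i - y))\<^sup>2)"
    and e: "0 \<le> e" "e\<^sup>2 = (\<Sum>i\<in>UNIV. q $ i * (norm (z i - y))\<^sup>2)"
    using nonneg by (simp_all add: B_def e_def)
  have \<sigma>: "0 \<le> \<sigma>" unfolding \<sigma>_def by (rule sigma_bar_contraction(1)[OF agents W q(1,2)])
  have "B\<^sup>2 \<le> (\<sigma> * e)\<^sup>2"
    unfolding B(2) Y power_mult_distrib e(2) \<sigma>_def
    by (rule mixing_contraction[OF agents W q y_def[symmetric]])
  then have Be: "B \<le> \<sigma> * e"
    by (rule power2_le_imp_le) (simp add: \<sigma> e)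
  \<comment> \<open>The average survives mixing, so the decompositions before and after it share the
    same \<open>A\<close>.\<close>
  have avgY: "(\<Sum>i\<in>UNIV. q $ i *\<^sub>R Y i) = y"
    unfolding vec_eq_iff y_def Y
    by (simp add: sum_vector_matrix_mult[OF q(2)])
  have Ys: "(\<Sum>i\<in>UNIV. q $ i * (norm (Y i - s))\<^sup>2) = A\<^sup>2 + B\<^sup>2"
    unfolding A_def B by (rule consensus_pythagoras[OF q(3) avgY])
  have zs: "(\<Sum>i\<in>UNIV. q $ i * (norm (z i - s))\<^sup>2) = A\<^sup>2 + e\<^sup>2"
    unfolding A_def e by (rule consensus_pythagoras[OF q(3) y_def[symmetric]])
  have qm: "qm \<le> q $ i" for i
    unfolding qm_def Q_mat_def by (rule lambda_min_diag_le)
  define U where "U = (\<Sum>c\<in>UNIV. (G Y $ c - G (\<lambda>_. s) $ c) * (Y (ow c) - s) $ c)"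
  define V where "V = (\<Sum>c\<in>UNIV. (G Y $ c - G (\<lambda>_. s) $ c)\<^sup>2 / q $ ow c)"
  have U: "\<mu>b * qm * A\<^sup>2 - 2 * l * A * B - l * B\<^sup>2 \<le> U"
    unfolding U_def
    by (rule extended_gradient_dot_lower_bound[OF q(1,3) lip mono qm A_def B])
  have V: "V \<le> l\<^sup>2 * (A\<^sup>2 + B\<^sup>2)"
    unfolding V_def Ys[symmetric] by (rule lip(2))
  have "(\<Sum>i\<in>UNIV. q $ i * (norm (a i - s))\<^sup>2) \<le> A\<^sup>2 + B\<^sup>2 - 2 * \<alpha> * U + \<alpha>\<^sup>2 * V"
    using projected_gradient_step[of q S ow "\<lambda>i. g i (Y i)" "\<lambda>i. g i s", OF q(1) S g(1) g(1) s a]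
    by (simp add: U_def V_def g(2) Ys)
  also have "\<dots> \<le> A\<^sup>2 + B\<^sup>2 - 2 * \<alpha> * (\<mu>b * qm * A\<^sup>2 - 2 * l * A * B - l * B\<^sup>2)
      + \<alpha>\<^sup>2 * (l\<^sup>2 * (A\<^sup>2 + B\<^sup>2))"
    using \<alpha> by (intro add_mono diff_mono order_refl mult_left_mono U V) simp_all
  also have "\<dots> = (1 - 2 * \<alpha> * \<mu>b * qm + \<alpha>\<^sup>2 * l\<^sup>2) * A\<^sup>2 + 4 * \<alpha> * l * A * B
      + (1 + 2 * \<alpha> * l + \<alpha>\<^sup>2 * l\<^sup>2) * B\<^sup>2"
    by (simp add: algebra_simps)
  \<comment> \<open>All coefficients of \<open>B\<close> are nonnegative, so the disagreement after
    mixing may be replaced by its bound.\<close>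
  also have "\<dots> \<le> (1 - 2 * \<alpha> * \<mu>b * qm + \<alpha>\<^sup>2 * l\<^sup>2) * A\<^sup>2 + 4 * \<alpha> * l * A * (\<sigma> * e)
      + (1 + 2 * \<alpha> * l + \<alpha>\<^sup>2 * l\<^sup>2) * (\<sigma> * e)\<^sup>2"
    using \<alpha> lip(1) B(1) Be
    by (intro add_mono order_refl mult_left_mono power_mono) (simp_all add: A_def)
  also have "\<dots> \<le> lambda_max (M_mat \<alpha> \<mu>b l W q) * (A\<^sup>2 + e\<^sup>2)"
    unfolding qm_def \<sigma>_def by (rule M_mat_quadratic_form_le)
  finally show ?thesis unfolding zs .
qed

text \<open>Comparing the two constants along a coordinate direction gives \<open>\<mu>b * sqrt q\<^sub>i \<le> l\<close> for the owner
  \<open>i\<close>, so the upper left entry of the matrix is at least \<open>(1 - \<alpha> l)\<^sup>2\<close>.\<close>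

lemma M_mat_trace_nonneg:
  fixes ow :: "'c::finite \<Rightarrow> 'a::finite" and G :: "('a \<Rightarrow> real^'c) \<Rightarrow> real^'c"
  assumes q: "\<And>i. 0 < q $ i" "(\<Sum>i\<in>UNIV. q $ i) = 1"
    and lip: "0 \<le> l" "\<And>Y Z. (\<Sum>c\<in>UNIV. (G Y $ c - G Z $ c)\<^sup>2 / q $ ow c)
        \<le> l\<^sup>2 * (\<Sum>i\<in>UNIV. q $ i * (norm (Y i - Z i))\<^sup>2)"
    and mono: "0 \<le> \<mu>b" "\<And>x y. \<mu>b * (\<Sum>c\<in>UNIV. q $ ow c * ((x - y) $ c)\<^sup>2)
        \<le> (G (\<lambda>_. x) - G (\<lambda>_. y)) \<bullet> (x - y)"
    and \<alpha>: "0 \<le> \<alpha>"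
  shows "0 \<le> M_mat \<alpha> \<mu>b l W q $ 1 $ 1 + M_mat \<alpha> \<mu>b l W q $ 2 $ 2"
proof -
  \<comment> \<open>Any coordinate serves; one exists because types are inhabited.\<close>
  define c :: 'c where "c = (SOME c. True)"
  define r where "r = q $ ow c"
  define e :: "real^'c" where "e = axis c 1"
  define u where "u c = G (\<lambda>_. e) $ c - G (\<lambda>_. 0) $ c" for c
  have r: "0 < r" by (simp add: r_def q)
  have "r \<le> (\<Sum>i\<in>UNIV. q $ i)"
    unfolding r_def using q(1) by (intro member_le_sum) (auto intro: less_imp_le)
  then have "r \<le> 1" by (simp add: q)
  have e: "(\<Sum>c\<in>UNIV. q $ ow c * ((e - 0) $ c)\<^sup>2) = r"
    by (simp add: e_def r_def axis_def if_distrib[of "\<lambda>x. x\<^sup>2"] if_distrib[of "\<lambda>x. _ * x"] cong: if_cong)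
  have "\<mu>b * r \<le> (\<Sum>c\<in>UNIV. u c * (e - 0) $ c)"
    using mono(2)[of e 0] unfolding e by (simp add: inner_vec_def u_def)
  also have "\<dots> \<le> l * sqrt r"
  proof -
    have "(\<Sum>c\<in>UNIV. (u c)\<^sup>2 / q $ ow c) \<le> l\<^sup>2"
      using lip(2)[of "\<lambda>_. e" "\<lambda>_. 0"]
      by (simp add: u_def e_def sum_distrib_right[symmetric] q(2))
    moreover have "(\<Sum>c\<in>UNIV. q $ ow c * ((e - 0) $ c)\<^sup>2) \<le> (sqrt r)\<^sup>2"
      unfolding e using r by simp
    ultimately have "\<bar>\<Sum>c\<in>UNIV. u c * (e - 0) $ c\<bar> \<le> l * sqrt r"
      using lip(1) r by (intro weighted_Cauchy_Schwarz[of "\<lambda>c. q $ ow c"] q) auto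
    then show ?thesis by linarith
  qed
  also have "\<dots> \<le> l" using lip(1) \<open>r \<le> 1\<close> by (simp add: mult_left_le)
  finally have "\<mu>b * r \<le> l" .
  moreover have "\<mu>b * lambda_min (Q_mat q) \<le> \<mu>b * r"
    unfolding r_def Q_mat_def by (intro mult_left_mono mono lambda_min_diag_le)
  ultimately have "\<alpha> * (\<mu>b * lambda_min (Q_mat q)) \<le> \<alpha> * l"
    using \<alpha> by (intro mult_left_mono) simp_all
  moreover have "0 \<le> (1 - \<alpha> * l)\<^sup>2" by simp
  ultimately have "0 \<le> M_mat \<alpha> \<mu>b l W q $ 1 $ 1"
    unfolding M_mat_entries by (simp add: power2_eq_square algebra_simps)
  moreover have "0 \<le> M_mat \<alpha> \<mu>b l W q $ 2 $ 2"
    unfolding M_mat_entries using \<alpha> lip(1) by simp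
  ultimately show ?thesis by simp
qed

section \<open>Passage from weighted matrices to sums\<close>

text \<open>Lets the hypotheses about vectors of the product space be applied to families of
  estimates, which \<open>est\<close> recovers.\<close>

definition stack :: "('a \<Rightarrow> real^'c) \<Rightarrow> real^('a::finite \<times> 'c::finite)" where
  "stack Y = (\<chi> p. Y (fst p) $ snd p)"

lemma est_stack: "est (stack Y) i = Y i"
  by (simp add: est_def stack_def vec_eq_iff)

lemma est_stack_diff: "est (stack Y - stack Z) i = Y i - Z i"
  by (simp add: est_diff est_stack)

lemma ext_pseudo_grad_stack:
  "ext_pseudo_grad ow J (stack Y) $ c = partial_grad ow (ow c) (J (ow c)) (Y (ow c)) $ c"
  by (simp add: ext_pseudo_grad_def est_stack)

lemma ext_pseudo_grad_stack_const: "ext_pseudo_grad ow J (stack (\<lambda>_. x)) = pseudo_grad ow J x"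
  by (simp add: vec_eq_iff ext_pseudo_grad_stack pseudo_grad_def)

lemma mixed_est_eq_sum:
  assumes "weighted_adjacency E W"
  shows "mixed_est E W X i = (\<Sum>j\<in>UNIV. W $ i $ j *\<^sub>R est X j)"
  unfolding mixed_est_def using assms
  by (intro sum.mono_neutral_left) (auto simp: weighted_adjacency_def split: if_splits)

lemma matrix_inv_Qbar:
  assumes "\<And>i. 0 < q $ i"
  shows "matrix_inv (Qbar_mat ow q) *v x = (\<chi> c. x $ c / q $ ow c)"
  unfolding Qbar_mat_def using assms by (subst matrix_inv_diag) (auto simp: diag_mult_vec less_imp_neq[symmetric])

text \<open>Weight and inverse weight cancel, so the hypothesis on \<open>\<mu>b\<close> becomes a
  lower bound for a plain inner product by a weighted norm.\<close>

lemma winner_Qbar_matrix_inv: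
  assumes "\<And>i. 0 < q $ i"
  shows "winner (Qbar_mat ow q) (matrix_inv (Qbar_mat ow q) *v a - matrix_inv (Qbar_mat ow q) *v b) d
    = (a - b) \<bullet> d"
proof -
  have "q $ i \<noteq> 0" for i using assms[of i] by simp
  then show ?thesis
    unfolding winner_def matrix_inv_Qbar[OF assms]
    by (simp add: Qbar_mat_def diag_mult_vec inner_vec_def diff_divide_distrib[symmetric])
qed

lemma wnorm_Qbar_sq:
  assumes "\<And>i. 0 < q $ i"
  shows "(wnorm (Qbar_mat ow q) x)\<^sup>2 = (\<Sum>c\<in>UNIV. q $ ow c * (x $ c)\<^sup>2)"
    "0 \<le> wnorm (Qbar_mat ow q) x"
  unfolding Qbar_mat_def using wnorm_diag_sq[of "\<chi> c. q $ ow c"]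
  by (simp_all add: less_imp_le[OF assms])

lemma wnorm_Qbar_matrix_inv_sq:
  assumes "\<And>i. 0 < q $ i"
  shows "(wnorm (Qbar_mat ow q) (matrix_inv (Qbar_mat ow q) *v a - matrix_inv (Qbar_mat ow q) *v b))\<^sup>2
    = (\<Sum>c\<in>UNIV. (a $ c - b $ c)\<^sup>2 / q $ ow c)"
proof -
  have "q $ i \<noteq> 0" for i using assms[of i] by simp
  then show ?thesis
    unfolding wnorm_Qbar_sq[OF assms] matrix_inv_Qbar[OF assms]
    by (simp add: diff_divide_distrib[symmetric] power_divide power2_eq_square)
qed

text \<open>All weights are positive, so the weighted norm dominates every coordinate up to the
  factor \<open>1 / sqrt (q $ fst p)\<close>.\<close>

lemma tendsto_of_wnorm_le_geometric:
  fixes X :: "nat \<Rightarrow> real^('a::finite \<times> 'c::finite)"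
  assumes q: "\<And>i. 0 < q $ i" and r: "0 \<le> r" "r < 1"
    and le: "\<And>k. wnorm (Qbold_mat q) (X k - L) \<le> r ^ k * C"
  shows "X \<longlonglongrightarrow> L"
proof (rule vec_tendstoI)
  fix p :: "'a \<times> 'c"
  have bound: "norm (X k $ p - L $ p) \<le> r ^ k * (C / sqrt (q $ fst p))" for k
  proof -
    have w: "0 \<le> wnorm (Qbold_mat q) (X k - L)" by (rule wnorm_Qbold_sq(2)[OF q])
    have "q $ fst p * ((X k - L) $ p)\<^sup>2 \<le> (\<Sum>p\<in>UNIV. q $ fst p * ((X k - L) $ p)\<^sup>2)"
      by (rule member_le_sum[of p UNIV "\<lambda>p. q $ fst p * ((X k - L) $ p)\<^sup>2"])
        (simp_all add: less_imp_le[OF q])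
    also have "\<dots> = (wnorm (Qbold_mat q) (X k - L))\<^sup>2"
      unfolding Qbold_mat_diag by (subst wnorm_diag_sq(1)) (simp_all add: less_imp_le[OF q])
    finally have "sqrt (q $ fst p * ((X k - L) $ p)\<^sup>2) \<le> wnorm (Qbold_mat q) (X k - L)"
      using w by (simp add: real_le_lsqrt)
    also have "\<dots> \<le> r ^ k * C" by (rule le)
    finally show ?thesis
      using q[of "fst p"] by (simp add: real_sqrt_mult field_simps)
  qed
  have "(\<lambda>k. r ^ k * (C / sqrt (q $ fst p))) \<longlonglongrightarrow> 0"
    using r by (intro tendsto_mult_left_zero LIMSEQ_power_zero) simp
  with always_eventually[OF allI[OF bound]] have "(\<lambda>k. X k $ p - L $ p) \<longlonglongrightarrow> 0"
    by (rule Lim_null_comparison)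
  then show "(\<lambda>k. X k $ p) \<longlonglongrightarrow> L $ p"
    by (simp add: LIM_zero_iff)
qed

text \<open>Only \<open>lambda_max < 1\<close> is assumed of the matrix; equality with the operator
  norm is part of the conclusion, as are existence and uniqueness of the equilibrium.\<close>

theorem theorem1:
  fixes ow :: "'c::finite \<Rightarrow> 'a::finite"
    and \<Omega> :: "'a \<Rightarrow> (real^'c) set"
    and J :: "'a \<Rightarrow> real^'c \<Rightarrow> real"
    and \<mu> l0 \<mu>b lb \<alpha> :: real
    and E :: "('a \<times> 'a) set"
    and W :: "real^'a^'a"
    and q :: "real^'a"
  assumes agents: "CARD('a) \<ge> 2"
    and feasible_sets: "\<And>i. \<Omega> i \<subseteq> block_space ow i"
      "\<And>i. \<Omega> i \<noteq> {}" "\<And>i. closed (\<Omega> i)" "\<And>i. convex (\<Omega> i)"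
    and J_cont: "\<And>i. continuous_on UNIV (J i)"
    and J_convex: "\<And>i x. convex_on (block_space ow i) (\<lambda>y. J i (with_block ow i y x))"
    and J_C1: "\<And>i x. continuously_diff (\<lambda>y. J i (with_block ow i y x))"
    and F_strongly_monotone: "\<mu> > 0"
      "\<And>x y. (pseudo_grad ow J x - pseudo_grad ow J y) \<bullet> (x - y) \<ge> \<mu> * (norm (x - y))\<^sup>2"
    and F_lipschitz: "l0 > 0" "l0-lipschitz_on UNIV (pseudo_grad ow J)"
    and strongly_connected: "\<And>i j. (i, j) \<in> E\<^sup>*"
    and W: "weighted_adjacency E W" "\<And>i. W $ i $ i > 0" "W *v (\<chi> i. 1) = (\<chi> i. 1)"
    and q: "\<And>i. q $ i > 0" "q v* W = q" "(\<Sum>i\<in>UNIV. q $ i) = 1"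
    and mu_bar: "\<mu>b > 0"
      "\<And>x y. winner (Qbar_mat ow q)
                (matrix_inv (Qbar_mat ow q) *v pseudo_grad ow J x
                   - matrix_inv (Qbar_mat ow q) *v pseudo_grad ow J y) (x - y)
              \<ge> \<mu>b * (wnorm (Qbar_mat ow q) (x - y))\<^sup>2"
    and l_bar: "lb > 0"
      "\<And>X Y :: real^('a \<times> 'c).
              wnorm (Qbar_mat ow q)
                (matrix_inv (Qbar_mat ow q) *v ext_pseudo_grad ow J X
                   - matrix_inv (Qbar_mat ow q) *v ext_pseudo_grad ow J Y)
              \<le> lb * wnorm (Qbold_mat q) (X - Y)"
    and \<alpha>: "\<alpha> > 0" "lambda_max (M_mat \<alpha> \<mu>b lb W q) < 1"
  shows "lambda_max (M_mat \<alpha> \<mu>b lb W q) = onorm ((*v) (M_mat \<alpha> \<mu>b lb W q)) \<and>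
    (\<exists>!xs. nash_equilibrium ow \<Omega> J xs) \<and>
    (\<forall>xs X. nash_equilibrium ow \<Omega> J xs \<and> generated_by_algorithm ow \<Omega> J E W q \<alpha> X \<longrightarrow>
       X \<longlonglongrightarrow> kron_vec (\<chi> i. 1) xs \<and>
       (\<forall>k. wnorm (Qbold_mat q) (X k - kron_vec (\<chi> i. 1) xs)
             \<le> sqrt (lambda_max (M_mat \<alpha> \<mu>b lb W q)) ^ k
               * wnorm (Qbold_mat q) (X 0 - kron_vec (\<chi> i. 1) xs)))"
proof -
  define M where "M = M_mat \<alpha> \<mu>b lb W q"
  define G where "G Y = ext_pseudo_grad ow J (stack Y)" for Y :: "'a \<Rightarrow> real^'c"
  have W_nonneg: "0 \<le> W $ i $ j" for i j
  proof (cases "(i, j) \<in> E")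
    case True
    then show ?thesis using W(1) unfolding weighted_adjacency_def by (metis less_imp_le)
  next
    case False
    then show ?thesis using W(1) unfolding weighted_adjacency_def by (metis order_refl)
  qed
  have lip: "(\<Sum>c\<in>UNIV. (G Y $ c - G Z $ c)\<^sup>2 / q $ ow c)
      \<le> lb\<^sup>2 * (\<Sum>i\<in>UNIV. q $ i * (norm (Y i - Z i))\<^sup>2)" for Y Z
    using power_mono[OF l_bar(2)[of "stack Y" "stack Z"] wnorm_Qbar_sq(2)[OF q(1)], of 2]
    by (simp add: wnorm_Qbar_matrix_inv_sq[OF q(1)] power_mult_distrib wnorm_Qbold_sq(1)[OF q(1)]
        est_stack_diff G_def)
  have mono: "\<mu>b * (\<Sum>c\<in>UNIV. q $ ow c * ((x - y) $ c)\<^sup>2)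
      \<le> (G (\<lambda>_. x) - G (\<lambda>_. y)) \<bullet> (x - y)" for x y
    using mu_bar(2)[of x y]
    unfolding winner_Qbar_matrix_inv[OF q(1)] wnorm_Qbar_sq(1)[OF q(1)] G_def
      ext_pseudo_grad_stack_const .
  have lb: "0 \<le> lb" and mu: "0 \<le> \<mu>b" and \<alpha>0: "0 \<le> \<alpha>"
    using l_bar(1) mu_bar(1) \<alpha>(1) by simp_all
  have trace: "0 \<le> M $ 1 $ 1 + M $ 2 $ 2"
    unfolding M_def by (rule M_mat_trace_nonneg[OF q(1,3) lb lip mu mono \<alpha>0])
  have sym: "transpose M = M" unfolding M_def by (rule transpose_M_mat)
  note onorm = onorm_eq_lambda_max_2[OF sym trace]
  note nash_iff = nash_equilibrium_iff_variational_solution[of \<Omega> ow J,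
      OF feasible_sets(1,4) J_convex J_C1]
  have "\<exists>!xs. nash_equilibrium ow \<Omega> J xs"
    unfolding nash_iff
    by (rule ex1_variational_solution[OF feasible_sets F_strongly_monotone F_lipschitz])
  moreover have "X \<longlonglongrightarrow> kron_vec (\<chi> i. 1) xs \<and>
      (\<forall>k. wnorm (Qbold_mat q) (X k - kron_vec (\<chi> i. 1) xs)
        \<le> sqrt (lambda_max M) ^ k * wnorm (Qbold_mat q) (X 0 - kron_vec (\<chi> i. 1) xs))"
    if xs: "nash_equilibrium ow \<Omega> J xs" and X: "generated_by_algorithm ow \<Omega> J E W q \<alpha> X" for xs X
  proof -
    define D where "D k = wnorm (Qbold_mat q) (X k - kron_vec (\<chi> i. 1) xs)" for k
    have D: "0 \<le> D k" "(D k)\<^sup>2 = (\<Sum>i\<in>UNIV. q $ i * (norm (est (X k) i - xs))\<^sup>2)" for k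
      unfolding D_def
      by (simp_all add: wnorm_Qbold_sq[OF q(1)] est_diff est_kron_vec_ones)
    have xs': "variational_solution ow \<Omega> J xs" using xs by (simp only: nash_iff)
    have "(D (Suc k))\<^sup>2 \<le> lambda_max M * (D k)\<^sup>2" for k
      unfolding D(2) M_def
    proof (rule contraction_step[OF agents W_nonneg W(3) q lb lip mu mono feasible_sets(3,4,2)])
      show "block ow i (partial_grad ow i (J i) x) = partial_grad ow i (J i) x" for i x
        by (rule block_partial_grad[OF J_C1])
      show "G Y $ c = partial_grad ow (ow c) (J (ow c)) (Y (ow c)) $ c" for Y c
        by (simp add: G_def ext_pseudo_grad_stack)
      \<comment> \<open>The equilibrium enters the contraction as a common fixed point of all
        agents' projected steps.\<close>
      show "block ow i xs = closest_point (\<Omega> i)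
          (block ow i xs - (\<alpha> / q $ i) *\<^sub>R partial_grad ow i (J i) xs)" for i
        using \<alpha>0 q(1)[of i]
        by (intro variational_solution_fixed_point[symmetric] feasible_sets xs') simp
      show "mixed_est E W (X k) i = (\<Sum>j\<in>UNIV. W $ i $ j *\<^sub>R est (X k) j)" for i
        by (rule mixed_est_eq_sum[OF W(1)])
      show "block ow i (est (X (Suc k)) i) = closest_point (\<Omega> i) (block ow i (mixed_est E W (X k) i)
          - (\<alpha> / q $ i) *\<^sub>R partial_grad ow i (J i) (mixed_est E W (X k) i))"
        and "ow c \<noteq> i \<Longrightarrow> est (X (Suc k)) i $ c = mixed_est E W (X k) i $ c" for i c
        using X by (simp_all add: generated_by_algorithm_def Let_def)
    qed (rule \<alpha>0)
    then have step: "D (Suc k) \<le> sqrt (lambda_max M) * D k" for k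
      using real_sqrt_le_mono[of "(D (Suc k))\<^sup>2" "lambda_max M * (D k)\<^sup>2"] D(1)
      by (simp add: real_sqrt_mult)
    have rate: "D k \<le> sqrt (lambda_max M) ^ k * D 0" for k
    proof (induction k)
      case (Suc k)
      \<comment> \<open>In HOL the root of a negative number is negative, so multiplying the
        induction hypothesis requires \<open>0 \<le> lambda_max M\<close>, which comes from the
        trace bound.\<close>
      have "D (Suc k) \<le> sqrt (lambda_max M) * (sqrt (lambda_max M) ^ k * D 0)"
        using step[of k] mult_left_mono[OF Suc] onorm(2) by (meson order_trans real_sqrt_ge_zero)
      then show ?case by (simp add: mult.assoc)
    qed simp
    have "X \<longlonglongrightarrow> kron_vec (\<chi> i. 1) xs"
      using rate \<alpha>(2) onorm(2) unfolding D_def M_def[symmetric]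
      by (intro tendsto_of_wnorm_le_geometric[OF q(1), of "sqrt (lambda_max M)"]) auto
    then show ?thesis using rate unfolding D_def by blast
  qed
  ultimately show ?thesis using onorm(1) unfolding M_def by blast
qed

end
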